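(* Let $G$ be any locally compact topological group with unit element $e$, and let $\Omega\subset G$ be an open symmetric neighborhood of $e$ (i.e. $\Omega=\Omega^{-1}$). Let $z\in\Omega$ be any element of finite order $o(z)=m<\infty$, and let $H_m:=H_m(\Omega,z):=\{k\in\mathbb{Z}_m: z^k\in\Omega\}$. Then $$\mathcal{C}^c_G(\Omega,z)=\mathcal{C}^{\#}_G(\Omega,z)=\mathcal{C}_m(H_m)\quad\text{and}\quad \mathcal{K}^c_G(\Omega,z)=\mathcal{K}^{\#}_G(\Omega,z)=\mathcal{K}_m(H_m).$$
   Context: Locally compact groups are Hausdorff and not assumed commutative. A function $f:G\to\mathbb{C}$ on a group $G$ is positive definite, written $f\gg0$, if for all $n\in\mathbb{N}$, $x_1,\dots,x_n\in G$ and $c_1,\dots,c_n\in\mathbb{C}$ one has $\sum_{j=1}^n\sum_{k=1}^n c_j\overline{c_k}f(x_jx_k^{-1})\ge0$. $\operatorname{supp} f$ is the closed support of $f$, and $\operatorname{supp} f\Subset\Omega$ means that $\operatorname{supp} f$ is compact and contained in $\Omega$. Function classes: $\mathcal{F}^{\#}_G(\Omega):=\{f:G\to\mathbb{C} : f\gg0,\ f(e)=1,\ f(x)=0\ \forall x\notin\Omega\}$ (no continuity or measurability required); $\mathcal{F}^{c}_G(\Omega):=\{f:G\to\mathbb{C} : f\gg0,\ f(e)=1,\ f\in C(G),\ \operatorname{supp} f\Subset\Omega\}$; $\mathcal{F}^{\#\mathbb{R}}_G(\Omega)$ and $\mathcal{F}^{c\mathbb{R}}_G(\Omega)$ are the subsets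 of real-valued functions in $\mathcal{F}^{\#}_G(\Omega)$ and $\mathcal{F}^{c}_G(\Omega)$, respectively. Extremal constants: $\mathcal{C}^{\#}_G(\Omega,z):=\sup\{|f(z)|:f\in\mathcal{F}^{\#}_G(\Omega)\}$, $\mathcal{C}^{c}_G(\Omega,z):=\sup\{|f(z)|:f\in\mathcal{F}^{c}_G(\Omega)\}$, $\mathcal{K}^{\#}_G(\Omega,z):=\sup\{|f(z)|:f\in\mathcal{F}^{\#\mathbb{R}}_G(\Omega)\}$, $\mathcal{K}^{c}_G(\Omega,z):=\sup\{|f(z)|:f\in\mathcal{F}^{c\mathbb{R}}_G(\Omega)\}$. For $\mathbb{Z}_m:=\mathbb{Z}/m\mathbb{Z}$ (written additively) and symmetric $H\subset\mathbb{Z}_m$ containing $0$: $\mathcal{C}_m(H):=\sup\{|\varphi(1)| : \varphi:\mathbb{Z}_m\to\mathbb{C},\ \varphi\gg0,\ \varphi(0)=1,\ \operatorname{supp}\varphi\subset H\}$, and $\mathcal{K}_m(H)$ is the same supremum restricted to real-valued $\varphi$. *)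

theory Defs
  imports "HOL-Analysis.Analysis" "HOL-Algebra.Multiplicative_Group"
    "HOL-Algebra.Elementary_Groups"
begin

locale locally_compact_group = group G
  for G :: "('a, 'b) monoid_scheme" (structure) and T :: "'a topology" +
  assumes topspace_carrier: "topspace T = carrier G"
    and continuous_mult: "continuous_map (prod_topology T T) T (\<lambda>(x, y). x \<otimes> y)"
    and continuous_inv: "continuous_map T T (\<lambda>x. inv x)"
    and Hausdorff: "Hausdorff_space T"
    and locally_compact: "locally_compact_space T"

(* Functions on a group are HOL functions on the ambient type; only their values on the
   carrier are ever constrained or used. *)

definition positive_definite :: "('a, 'b) monoid_scheme \<Rightarrow> ('a \<Rightarrow> complex) \<Rightarrow> bool"
  where "positive_definite G f \<longleftrightarrow>
    (\<forall>(n::nat) (x::nat \<Rightarrow> 'a) (c::nat \<Rightarrow> complex). (\<forall>j<n. x j \<in> carrier G) \<longrightarrow>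
      (\<Sum>j<n. \<Sum>k<n. c j * cnj (c k) * f (x j \<otimes>\<^bsub>G\<^esub> inv\<^bsub>G\<^esub> (x k))) \<in> \<real>\<^sub>\<ge>\<^sub>0)"

definition closed_support :: "'a topology \<Rightarrow> ('a \<Rightarrow> complex) \<Rightarrow> 'a set"
  where "closed_support T f = T closure_of {x \<in> topspace T. f x \<noteq> 0}"

definition F_sharp :: "('a, 'b) monoid_scheme \<Rightarrow> 'a set \<Rightarrow> ('a \<Rightarrow> complex) set"
  where "F_sharp G \<Omega> =
    {f. positive_definite G f \<and> f \<one>\<^bsub>G\<^esub> = 1 \<and> (\<forall>x \<in> carrier G - \<Omega>. f x = 0)}"

definition F_cont :: "('a, 'b) monoid_scheme \<Rightarrow> 'a topology \<Rightarrow> 'a set \<Rightarrow> ('a \<Rightarrow> complex) set"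
  where "F_cont G T \<Omega> =
    {f. positive_definite G f \<and> f \<one>\<^bsub>G\<^esub> = 1 \<and> continuous_map T euclidean f \<and>
        compactin T (closed_support T f) \<and> closed_support T f \<subseteq> \<Omega>}"

definition real_valued :: "('a, 'b) monoid_scheme \<Rightarrow> ('a \<Rightarrow> complex) set"
  where "real_valued G = {f. \<forall>x \<in> carrier G. f x \<in> \<real>}"

definition C_sharp :: "('a, 'b) monoid_scheme \<Rightarrow> 'a set \<Rightarrow> 'a \<Rightarrow> real"
  where "C_sharp G \<Omega> z = (SUP f \<in> F_sharp G \<Omega>. cmod (f z))"

definition C_cont :: "('a, 'b) monoid_scheme \<Rightarrow> 'a topology \<Rightarrow> 'a set \<Rightarrow> 'a \<Rightarrow> real"
  where "C_cont G T \<Omega> z = (SUP f \<in> F_cont G T \<Omega>. cmod (f z))"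

definition K_sharp :: "('a, 'b) monoid_scheme \<Rightarrow> 'a set \<Rightarrow> 'a \<Rightarrow> real"
  where "K_sharp G \<Omega> z = (SUP f \<in> F_sharp G \<Omega> \<inter> real_valued G. cmod (f z))"

definition K_cont :: "('a, 'b) monoid_scheme \<Rightarrow> 'a topology \<Rightarrow> 'a set \<Rightarrow> 'a \<Rightarrow> real"
  where "K_cont G T \<Omega> z = (SUP f \<in> F_cont G T \<Omega> \<inter> real_valued G. cmod (f z))"

(* The cyclic group of order m is integer_mod_group m, with carrier {0..<m} for m > 0. *)

definition F_cyclic :: "nat \<Rightarrow> int set \<Rightarrow> (int \<Rightarrow> complex) set"
  where "F_cyclic m H =
    {\<phi>. positive_definite (integer_mod_group m) \<phi> \<and> \<phi> 0 = 1 \<and>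
        {k \<in> carrier (integer_mod_group m). \<phi> k \<noteq> 0} \<subseteq> H}"

(* The residue class of 1 is represented by 1 mod m, which is 0 when m = 1. *)

definition C_cyclic :: "nat \<Rightarrow> int set \<Rightarrow> real"
  where "C_cyclic m H = (SUP \<phi> \<in> F_cyclic m H. cmod (\<phi> (1 mod int m)))"

definition K_cyclic :: "nat \<Rightarrow> int set \<Rightarrow> real"
  where "K_cyclic m H =
    (SUP \<phi> \<in> F_cyclic m H \<inter> real_valued (integer_mod_group m). cmod (\<phi> (1 mod int m)))"

definition power_indices :: "('a, 'b) monoid_scheme \<Rightarrow> nat \<Rightarrow> 'a set \<Rightarrow> 'a \<Rightarrow> int set"
  where "power_indices G m \<Omega> z = {k \<in> carrier (integer_mod_group m). z [^]\<^bsub>G\<^esub> k \<in> \<Omega>}"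

end

theory Submission
  imports Defs
begin

text \<open>All suprema are taken over the same set of values. Restricting \<open>f\<close> to the powers of \<open>z\<close> turns an
  admissible function on \<open>G\<close> into one on \<open>\<int>\<^sub>m\<close>. Conversely, for an admissible \<open>\<phi>\<close> on \<open>\<int>\<^sub>m\<close> let \<open>h \<ge> 0\<close> be
  a continuous bump at the unit, invariant under conjugation by \<open>z\<close> and supported in a very small
  compact set \<open>K\<close>, and let
  \<open>F x = (\<Sum>a b. \<phi> (b - a) \<integral> h (x\<inverse> y z\<^sup>b) h (y z\<^sup>a) dy)\<close> with respect to left Haar measure. This is
  continuous and positive definite, lives on the union of the sets \<open>K z\<^sup>l K\<inverse>\<close> with \<open>\<phi> l \<noteq> 0\<close>, and
  satisfies \<open>F (z\<^sup>s) = N \<phi> s\<close> for a constant \<open>N > 0\<close>. Averaging over \<open>a\<close> makes right invariance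
  unnecessary. The Haar integral on \<open>C\<^sub>c(G)\<close> is obtained by Weil's covering argument: ratios of
  covering numbers become additive as the covering set shrinks, and a limit exists by
  Tychonoff's theorem.\<close>

section \<open>Finite sums for positive definite functions\<close>

text \<open>The test points are all residues, each taken once, so the weights become an arbitrary
  function on the cyclic group. This is the form in which \<open>smear_positive_definite\<close>
  uses the hypothesis on \<open>\<phi>\<close>.\<close>

lemma positive_definite_cyclic_sum:
  assumes "positive_definite (integer_mod_group m) \<phi>" "m > 0"
  shows "(\<Sum>a\<in>{0..<int m}. \<Sum>b\<in>{0..<int m}. c a * cnj (c b) * \<phi> ((a - b) mod int m)) \<in> \<real>\<^sub>\<ge>\<^sub>0"
proof -
  let ?Z = "integer_mod_group m"
  have shift: "sum f {0..<int m} = (\<Sum>j<m. f (int j))" for f :: "int \<Rightarrow> complex"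
    by (rule sum.reindex_bij_witness[of _ int nat]) auto
  have car: "int j \<in> carrier ?Z" if "j < m" for j
    using that by (simp add: carrier_integer_mod_group)
  then have "(\<Sum>j<m. \<Sum>k<m. c (int j) * cnj (c (int k)) * \<phi> (int j \<otimes>\<^bsub>?Z\<^esub> inv\<^bsub>?Z\<^esub> (int k))) \<in> \<real>\<^sub>\<ge>\<^sub>0"
    using assms(1)[unfolded positive_definite_def, rule_format, of m int "\<lambda>j. c (int j)"] by blast
  also have "(\<Sum>j<m. \<Sum>k<m. c (int j) * cnj (c (int k)) * \<phi> (int j \<otimes>\<^bsub>?Z\<^esub> inv\<^bsub>?Z\<^esub> (int k)))
    = (\<Sum>j<m. \<Sum>k<m. c (int j) * cnj (c (int k)) * \<phi> ((int j - int k) mod int m))"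
    using car by (intro sum.cong refl) (simp add: mod_add_right_eq)
  also have "\<dots> = (\<Sum>a\<in>{0..<int m}. \<Sum>b\<in>{0..<int m}. c a * cnj (c b) * \<phi> ((a - b) mod int m))"
    by (simp add: shift)
  finally show ?thesis .
qed

lemma positive_definite_scale:
  assumes "positive_definite G f" "0 \<le> r"
  shows "positive_definite G (\<lambda>x. complex_of_real r * f x)"
  unfolding positive_definite_def
proof (intro allI impI)
  fix n :: nat and x c assume x: "\<forall>j<n. x j \<in> carrier G"
  have "(\<Sum>j<n. \<Sum>k<n. c j * cnj (c k) * (complex_of_real r * f (x j \<otimes>\<^bsub>G\<^esub> inv\<^bsub>G\<^esub> x k)))
    = complex_of_real r * (\<Sum>j<n. \<Sum>k<n. c j * cnj (c k) * f (x j \<otimes>\<^bsub>G\<^esub> inv\<^bsub>G\<^esub> x k))"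
    by (simp add: sum_distrib_left mult.left_commute)
  moreover have "(\<Sum>j<n. \<Sum>k<n. c j * cnj (c k) * f (x j \<otimes>\<^bsub>G\<^esub> inv\<^bsub>G\<^esub> x k)) \<in> \<real>\<^sub>\<ge>\<^sub>0"
    using assms(1) x unfolding positive_definite_def by blast
  ultimately show "(\<Sum>j<n. \<Sum>k<n. c j * cnj (c k) * (complex_of_real r * f (x j \<otimes>\<^bsub>G\<^esub> inv\<^bsub>G\<^esub> x k))) \<in> \<real>\<^sub>\<ge>\<^sub>0"
    using assms(2) by (simp add: complex_nonneg_Reals_iff)
qed

lemma sum_swap3:
  "(\<Sum>i\<in>A. \<Sum>j\<in>B. \<Sum>k\<in>C. g i j k) = (\<Sum>k\<in>C. \<Sum>j\<in>B. \<Sum>i\<in>A. g i j k)"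
proof -
  have "(\<Sum>i\<in>A. \<Sum>j\<in>B. \<Sum>k\<in>C. g i j k) = (\<Sum>i\<in>A. \<Sum>k\<in>C. \<Sum>j\<in>B. g i j k)"
    by (intro sum.cong refl sum.swap)
  also have "\<dots> = (\<Sum>k\<in>C. \<Sum>i\<in>A. \<Sum>j\<in>B. g i j k)"
    by (rule sum.swap)
  also have "\<dots> = (\<Sum>k\<in>C. \<Sum>j\<in>B. \<Sum>i\<in>A. g i j k)"
    by (intro sum.cong refl sum.swap)
  finally show ?thesis .
qed

context locally_compact_group
begin

subsection \<open>Covering numbers\<close>

definition unit_nbhd :: "'a set \<Rightarrow> bool"
  where "unit_nbhd V \<longleftrightarrow> openin T V \<and> \<one> \<in> V"

definition Cc :: "('a \<Rightarrow> real) set"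
  where "Cc = {f. continuous_map T euclideanreal f \<and> (\<forall>x\<in>carrier G. 0 \<le> f x) \<and>
    (\<exists>K. compactin T K \<and> (\<forall>x\<in>carrier G - K. f x = 0))}"

definition compactly_dominated :: "('a \<Rightarrow> real) \<Rightarrow> bool"
  where "compactly_dominated f \<longleftrightarrow>
    (\<exists>K M. compactin T K \<and> 0 \<le> M \<and> (\<forall>x\<in>carrier G. f x \<le> M * indicator K x))"

text \<open>A list of pairs \<open>(c, x)\<close> stands for the combination of the indicators of the translates \<open>x V\<close>
  with weights \<open>c\<close>. Note that \<open>cov V f\<close> is a junk value when no finite combination dominates \<open>f\<close>.\<close>

definition cover_val :: "'a set \<Rightarrow> (real \<times> 'a) list \<Rightarrow> 'a \<Rightarrow> real"
  where "cover_val V L y = (\<Sum>(c, x)\<leftarrow>L. c * indicator V (inv x \<otimes> y))"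

definition is_cover :: "'a set \<Rightarrow> ('a \<Rightarrow> real) \<Rightarrow> (real \<times> 'a) list \<Rightarrow> bool"
  where "is_cover V f L \<longleftrightarrow>
    (\<forall>(c, x)\<in>set L. 0 \<le> c \<and> x \<in> carrier G) \<and> (\<forall>y\<in>carrier G. f y \<le> cover_val V L y)"

definition cov :: "'a set \<Rightarrow> ('a \<Rightarrow> real) \<Rightarrow> real"
  where "cov V f = Inf {sum_list (map fst L) | L. is_cover V f L}"

lemma continuous_map_mult:
  assumes "continuous_map X T f" "continuous_map X T g"
  shows "continuous_map X T (\<lambda>x. f x \<otimes> g x)"
  using continuous_map_compose[OF continuous_map_pairedI[OF assms] continuous_mult]
  by (simp add: o_def case_prod_unfold)

lemma continuous_map_m_inv:
  assumes "continuous_map X T f"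
  shows "continuous_map X T (\<lambda>x. inv (f x))"
  using continuous_map_compose[OF assms continuous_inv] by (simp add: o_def)

lemma continuous_map_group_const: "c \<in> carrier G \<Longrightarrow> continuous_map X T (\<lambda>x. c)"
  by (simp add: topspace_carrier)

lemma compactin_subset_carrier: "compactin T K \<Longrightarrow> K \<subseteq> carrier G"
  using compactin_subset_topspace topspace_carrier by blast

text \<open>The sets \<open>y u\<inverse> U\<close> with \<open>y\<close> in \<open>K\<close> form
  an open cover of \<open>K\<close>. As \<open>U\<close> may lie away from the unit, it can later be
  the set where a given function is large.\<close>

lemma compact_finite_translates:
  assumes K: "compactin T K" and U: "openin T U" and u: "u \<in> U"
  obtains xs where "set xs \<subseteq> carrier G" "\<And>y. y \<in> K \<Longrightarrow> \<exists>x\<in>set xs. inv x \<otimes> y \<in> U"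
proof -
  have uc: "u \<in> carrier G"
    using U u openin_subset topspace_carrier by blast
  have Kc: "K \<subseteq> carrier G"
    using K by (rule compactin_subset_carrier)
  define W where "W x = {y \<in> topspace T. inv x \<otimes> y \<in> U}" for x
  have op: "openin T (W x)" if "x \<in> carrier G" for x
    unfolding W_def using that
    by (intro openin_continuous_map_preimage[OF _ U] continuous_map_mult continuous_map_group_const
        continuous_map_id[unfolded id_def]) auto
  have "K \<subseteq> \<Union>(W ` carrier G)"
  proof
    fix y assume "y \<in> K"
    then have y: "y \<in> carrier G" using Kc by auto
    then have "inv (y \<otimes> inv u) \<otimes> y = u"
      using uc by (simp add: inv_mult_group m_assoc)
    then have "y \<in> W (y \<otimes> inv u)"
      using y u by (simp add: W_def topspace_carrier)
    then show "y \<in> \<Union>(W ` carrier G)"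
      using y uc by (meson UN_I inv_closed m_closed)
  qed
  then obtain F where "finite F" "F \<subseteq> W ` carrier G" "K \<subseteq> \<Union>F"
    using compactinD[OF K, of "W ` carrier G"] op by blast
  then obtain S where S: "finite S" "S \<subseteq> carrier G" "K \<subseteq> \<Union>(W ` S)"
    by (metis finite_subset_image)
  then obtain xs where "set xs = S" using finite_list by blast
  then show ?thesis using S that[of xs] by (force simp: W_def)
qed

lemma Cc_dominated:
  assumes "f \<in> Cc" shows "compactly_dominated f"
proof -
  obtain K where f: "continuous_map T euclideanreal f" and K: "compactin T K"
    and z: "\<forall>x\<in>carrier G - K. f x = 0"
    using assms by (auto simp: Cc_def)
  have "compact (f ` K)"
    using image_compactin[OF K f] by simp
  then obtain M where M: "\<And>x. x \<in> K \<Longrightarrow> \<bar>f x\<bar> \<le> M"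
    using compact_imp_bounded bounded_real by (metis imageI)
  \<comment> \<open>The absolute value is for empty \<open>K\<close>, where \<open>M\<close> may be
    negative.\<close>
  show ?thesis
    unfolding compactly_dominated_def
    using K z M by (intro exI[of _ K] exI[of _ "\<bar>M\<bar>"]) (fastforce simp: indicator_def)
qed

lemma dominated_add:
  assumes "compactly_dominated f" "compactly_dominated g"
  shows "compactly_dominated (\<lambda>x. f x + g x)"
proof -
  obtain K M L N where K: "compactin T K" "0 \<le> M" "\<forall>x\<in>carrier G. f x \<le> M * indicator K x"
    and L: "compactin T L" "0 \<le> N" "\<forall>x\<in>carrier G. g x \<le> N * indicator L x"
    using assms unfolding compactly_dominated_def by metis
  have "f x + g x \<le> (M + N) * indicator (K \<union> L) x" if "x \<in> carrier G" for x
  proof -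
    have "f x + g x \<le> M * indicator K x + N * indicator L x"
      using K(3) L(3) that by (intro add_mono) auto
    also have "\<dots> \<le> (M + N) * indicator (K \<union> L) x"
      using K(2) L(2) by (auto simp: indicator_def)
    finally show ?thesis .
  qed
  then show ?thesis
    unfolding compactly_dominated_def using K L compactin_Un[of T K L] by (meson add_nonneg_nonneg)
qed

lemma dominated_scale:
  assumes "compactly_dominated f" "0 \<le> c"
  shows "compactly_dominated (\<lambda>x. c * f x)"
proof -
  obtain K M where K: "compactin T K" "0 \<le> M" "\<forall>x\<in>carrier G. f x \<le> M * indicator K x"
    using assms unfolding compactly_dominated_def by metis
  then have "\<forall>x\<in>carrier G. c * f x \<le> (c * M) * indicator K x"
    using assms(2) by (simp add: mult.assoc mult_left_mono)
  then show ?thesis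
    unfolding compactly_dominated_def using K assms(2) by (meson mult_nonneg_nonneg)
qed

lemma compactin_translate:
  assumes "compactin T K" "a \<in> carrier G" "b \<in> carrier G"
  shows "compactin T ((\<lambda>x. a \<otimes> x \<otimes> b) ` K)"
  using assms
  by (intro image_compactin[OF assms(1)] continuous_map_mult continuous_map_group_const
      continuous_map_id[unfolded id_def]) auto

lemma dominated_translate:
  assumes "compactly_dominated f" "a \<in> carrier G"
  shows "compactly_dominated (\<lambda>x. f (a \<otimes> x))"
proof -
  obtain K M where K: "compactin T K" "0 \<le> M" "\<forall>x\<in>carrier G. f x \<le> M * indicator K x"
    using assms unfolding compactly_dominated_def by metis
  define K' where "K' = (\<lambda>x. inv a \<otimes> x \<otimes> \<one>) ` K"
  have K': "x \<in> K'" if "x \<in> carrier G" "a \<otimes> x \<in> K" for x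
    unfolding K'_def using that assms(2)
    by (intro image_eqI[of _ _ "a \<otimes> x"]) (auto simp: m_assoc[symmetric])
  have "f (a \<otimes> x) \<le> M * indicator K' x" if x: "x \<in> carrier G" for x
  proof -
    have "f (a \<otimes> x) \<le> M * indicator K (a \<otimes> x)"
      using K(3) x assms(2) by blast
    also have "\<dots> \<le> M * indicator K' x"
      using K(2) K'[OF x] by (auto simp: indicator_def)
    finally show ?thesis .
  qed
  moreover have "compactin T K'"
    unfolding K'_def using K(1) assms(2) by (intro compactin_translate) auto
  ultimately show ?thesis
    unfolding compactly_dominated_def using K(2) by blast
qed

lemma cover_val_append: "cover_val V (L @ M) y = cover_val V L y + cover_val V M y"
  by (simp add: cover_val_def)

lemma cover_val_nonneg:
  "(\<And>c x. (c, x) \<in> set L \<Longrightarrow> 0 \<le> c) \<Longrightarrow> 0 \<le> cover_val V L y"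
  unfolding cover_val_def by (intro sum_list_nonneg) (auto simp: indicator_def)

lemma cover_val_ge:
  assumes "\<And>c x. (c, x) \<in> set L \<Longrightarrow> 0 \<le> c" "(d, x) \<in> set L" "inv x \<otimes> y \<in> V"
  shows "d \<le> cover_val V L y"
proof -
  have "d * indicator V (inv x \<otimes> y) \<le> cover_val V L y"
    unfolding cover_val_def using assms
    by (intro member_le_sum_list) (force simp: indicator_def)+
  then show ?thesis using assms(3) by simp
qed

text \<open>Finitely many translates of \<open>V\<close> cover the dominating compact set, and each
  gets the weight \<open>M\<close>. Hence the infimum in \<open>cov\<close> is over a nonempty
  set.\<close>

lemma cover_exists:
  assumes "unit_nbhd V" "compactly_dominated f"
  shows "\<exists>L. is_cover V f L"
proof -
  obtain K M where K: "compactin T K" "0 \<le> M" "\<forall>x\<in>carrier G. f x \<le> M * indicator K x"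
    using assms unfolding compactly_dominated_def by metis
  obtain xs where xs: "set xs \<subseteq> carrier G" "\<And>y. y \<in> K \<Longrightarrow> \<exists>x\<in>set xs. inv x \<otimes> y \<in> V"
    using compact_finite_translates[OF K(1)] assms(1) unfolding unit_nbhd_def by metis
  define L where "L = map (\<lambda>x. (M, x)) xs"
  have nn: "0 \<le> c" if "(c, x) \<in> set L" for c x
    using that K(2) by (auto simp: L_def)
  have "f y \<le> cover_val V L y" if y: "y \<in> carrier G" for y
  proof (cases "y \<in> K")
    case True
    then obtain x where "x \<in> set xs" "inv x \<otimes> y \<in> V" using xs(2) by blast
    then have "M \<le> cover_val V L y"
      by (intro cover_val_ge[OF nn]) (auto simp: L_def)
    then show ?thesis using K(3) y True by fastforce
  next
    case False
    then have "f y \<le> 0" using K(3) y by fastforce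
    also have "0 \<le> cover_val V L y" using nn by (rule cover_val_nonneg)
    finally show ?thesis .
  qed
  then have "is_cover V f L"
    unfolding is_cover_def using xs(1) K(2) by (auto simp: L_def)
  then show ?thesis ..
qed

lemma is_cover_sum_nonneg: "is_cover V f L \<Longrightarrow> 0 \<le> sum_list (map fst L)"
  unfolding is_cover_def by (intro sum_list_nonneg) auto

lemma cov_le: "is_cover V f L \<Longrightarrow> cov V f \<le> sum_list (map fst L)"
  unfolding cov_def using is_cover_sum_nonneg by (intro cInf_lower bdd_belowI[of _ 0]) auto

lemma cov_greatest:
  assumes "unit_nbhd V" "compactly_dominated f"
    and "\<And>L. is_cover V f L \<Longrightarrow> r \<le> sum_list (map fst L)"
  shows "r \<le> cov V f"
  unfolding cov_def using assms(3) cover_exists[OF assms(1,2)] by (intro cInf_greatest) auto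

lemma cov_nonneg: "unit_nbhd V \<Longrightarrow> compactly_dominated f \<Longrightarrow> 0 \<le> cov V f"
  by (intro cov_greatest is_cover_sum_nonneg)

lemma cov_mono:
  assumes "unit_nbhd V" "compactly_dominated g" "\<And>x. x \<in> carrier G \<Longrightarrow> f x \<le> g x"
  shows "cov V f \<le> cov V g"
proof (rule cov_greatest[OF assms(1,2)])
  fix L assume "is_cover V g L"
  then have "is_cover V f L"
    using assms(3) unfolding is_cover_def by (meson order_trans)
  then show "cov V f \<le> sum_list (map fst L)" by (rule cov_le)
qed

lemma cov_add_le:
  assumes V: "unit_nbhd V" and f: "compactly_dominated f" and g: "compactly_dominated g"
  shows "cov V (\<lambda>x. f x + g x) \<le> cov V f + cov V g"
proof -
  have *: "cov V (\<lambda>x. f x + g x) \<le> sum_list (map fst L) + sum_list (map fst M)"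
    if L: "is_cover V f L" and M: "is_cover V g M" for L M
  proof -
    have "is_cover V (\<lambda>x. f x + g x) (L @ M)"
      using L M by (auto simp: is_cover_def cover_val_append intro!: add_mono)
    then show ?thesis using cov_le by fastforce
  qed
  \<comment> \<open>Concatenated covers give the bound for every pair \<open>L\<close>,
    \<open>M\<close>. The infimum is taken over \<open>M\<close> with \<open>L\<close> fixed, and
    then over \<open>L\<close>.\<close>
  then have "cov V (\<lambda>x. f x + g x) - sum_list (map fst L) \<le> cov V g" if "is_cover V f L" for L
    using * [OF that] by (intro cov_greatest[OF V g]) (simp add: algebra_simps)
  then have "cov V (\<lambda>x. f x + g x) - cov V g \<le> cov V f"
    by (intro cov_greatest[OF V f]) (simp add: algebra_simps)
  then show ?thesis by simp
qed

lemma cov_zero: "cov V (\<lambda>x. 0) = 0" if "unit_nbhd V"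
proof (rule antisym)
  have "is_cover V (\<lambda>x. 0) []" by (simp add: is_cover_def cover_val_def)
  then show "cov V (\<lambda>x. 0) \<le> 0" using cov_le by fastforce
  have "compactly_dominated (\<lambda>x. 0)"
    unfolding compactly_dominated_def by (intro exI[of _ "{}"] exI[of _ 0]) auto
  then show "0 \<le> cov V (\<lambda>x. 0)" using that cov_nonneg by blast
qed

lemma cover_val_scale: "cover_val V (map (\<lambda>(c, x). (d * c, x)) L) y = d * cover_val V L y"
  by (induction L) (auto simp: cover_val_def algebra_simps)

lemma sum_fst_scale: "sum_list (map fst (map (\<lambda>(c, x). (d * c, x)) L)) = (d::real) * sum_list (map fst L)"
  by (induction L) (auto simp: algebra_simps)

text \<open>Scaling the weights of a cover gives one inequality for every positive factor. The other
  one is the same inequality for the factor \<open>1 / d\<close> applied to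
  \<open>d * f\<close>.\<close>

lemma cov_scale:
  assumes V: "unit_nbhd V" and f: "compactly_dominated f" and d: "0 \<le> d"
  shows "cov V (\<lambda>x. d * f x) = d * cov V f"
proof -
  have le: "cov V (\<lambda>x. d * f x) \<le> d * cov V f" if d: "0 < d" and f: "compactly_dominated f" for d f
  proof -
    have "cov V (\<lambda>x. d * f x) / d \<le> sum_list (map fst L)" if L: "is_cover V f L" for L
    proof -
      have "is_cover V (\<lambda>x. d * f x) (map (\<lambda>(c, x). (d * c, x)) L)"
        using L d by (auto simp: is_cover_def cover_val_scale)
      then show ?thesis
        using cov_le[of V _ "map (\<lambda>(c, x). (d * c, x)) L"] d
        unfolding sum_fst_scale by (simp add: field_simps)
    qed
    then have "cov V (\<lambda>x. d * f x) / d \<le> cov V f" by (intro cov_greatest[OF V f])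
    then show ?thesis using d by (simp add: field_simps)
  qed
  show ?thesis
  proof (cases "d = 0")
    case False
    then have d: "0 < d" using assms by simp
    have "cov V (\<lambda>x. (1 / d) * (d * f x)) \<le> (1 / d) * cov V (\<lambda>x. d * f x)"
      using d f by (intro le dominated_scale) auto
    then have "d * cov V f \<le> cov V (\<lambda>x. d * f x)" using d by (simp add: field_simps)
    then show ?thesis using le[OF d f] by simp
  qed (simp add: cov_zero[OF V])
qed

lemma cover_val_translate:
  assumes "a \<in> carrier G" "y \<in> carrier G" "\<forall>(c, x)\<in>set L. x \<in> carrier G"
  shows "cover_val V (map (\<lambda>(c, x). (c, inv a \<otimes> x)) L) y = cover_val V L (a \<otimes> y)"
  using assms(3)
  by (induction L) (use assms(1,2) in \<open>auto simp: cover_val_def inv_mult_group m_assoc\<close>)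

lemma cov_translate:
  assumes V: "unit_nbhd V" and f: "compactly_dominated f" and a: "a \<in> carrier G"
  shows "cov V (\<lambda>x. f (a \<otimes> x)) = cov V f"
proof -
  have le: "cov V (\<lambda>x. f (a \<otimes> x)) \<le> cov V f" if f: "compactly_dominated f" and a: "a \<in> carrier G" for f a
  proof (rule cov_greatest[OF V f])
    fix L assume L: "is_cover V f L"
    have "is_cover V (\<lambda>x. f (a \<otimes> x)) (map (\<lambda>(c, x). (c, inv a \<otimes> x)) L)"
      unfolding is_cover_def
    proof (intro conjI ballI)
      fix y assume y: "y \<in> carrier G"
      have "cover_val V (map (\<lambda>(c, x). (c, inv a \<otimes> x)) L) y = cover_val V L (a \<otimes> y)"
        using L by (intro cover_val_translate a y) (auto simp: is_cover_def)
      then show "f (a \<otimes> y) \<le> cover_val V (map (\<lambda>(c, x). (c, inv a \<otimes> x)) L) y"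
        using L a y by (simp add: is_cover_def)
    qed (use L a in \<open>auto simp: is_cover_def\<close>)
    moreover have "map fst (map (\<lambda>(c, x). (c, inv a \<otimes> x)) L) = map fst L" by auto
    ultimately show "cov V (\<lambda>x. f (a \<otimes> x)) \<le> sum_list (map fst L)"
      using cov_le by metis
  qed
  \<comment> \<open>The double translate is known to agree with \<open>f\<close> only on the
    carrier, hence monotonicity in place of rewriting.\<close>
  have "cov V f \<le> cov V (\<lambda>x. f (a \<otimes> (inv a \<otimes> x)))"
    using a dominated_translate[OF dominated_translate[OF f a], of "inv a"]
    by (intro cov_mono[OF V]) (auto simp: m_assoc[symmetric])
  also have "\<dots> \<le> cov V (\<lambda>x. f (a \<otimes> x))"
    using a by (intro le dominated_translate[OF f]) auto
  finally show ?thesis using le[OF f a] by simp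
qed

text \<open>At a single point each translate contributes at most its weight. This makes
  \<open>cov V f0\<close> positive when \<open>f0\<close> is positive somewhere, so it can serve as
  the normalising denominator.\<close>

lemma cov_ge_value:
  assumes V: "unit_nbhd V" and f: "compactly_dominated f" and x: "x \<in> carrier G"
  shows "f x \<le> cov V f"
proof (rule cov_greatest[OF V f])
  fix L assume L: "is_cover V f L"
  then have "f x \<le> cover_val V L x" using x by (simp add: is_cover_def)
  also have "\<dots> \<le> sum_list (map fst L)"
    unfolding cover_val_def using L
    by (intro sum_list_mono) (auto simp: is_cover_def indicator_def)
  finally show "f x \<le> sum_list (map fst L)" .
qed

lemma cov_sum_translates:
  assumes V: "unit_nbhd V" and g: "compactly_dominated g" and "set xs \<subseteq> carrier G"
  shows "compactly_dominated (\<lambda>y. \<Sum>x\<leftarrow>xs. g (inv x \<otimes> y)) \<and>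
    cov V (\<lambda>y. \<Sum>x\<leftarrow>xs. g (inv x \<otimes> y)) \<le> real (length xs) * cov V g"
  using assms(3)
proof (induction xs)
  case Nil
  have "compactly_dominated (\<lambda>x. 0)"
    unfolding compactly_dominated_def by (intro exI[of _ "{}"] exI[of _ 0]) auto
  then show ?case using cov_zero[OF V] by simp
next
  case (Cons a xs)
  have a: "inv a \<in> carrier G" using Cons by auto
  have IH: "compactly_dominated (\<lambda>y. \<Sum>x\<leftarrow>xs. g (inv x \<otimes> y))"
    "cov V (\<lambda>y. \<Sum>x\<leftarrow>xs. g (inv x \<otimes> y)) \<le> real (length xs) * cov V g"
    using Cons by auto
  show ?case
    using dominated_add[OF dominated_translate[OF g a] IH(1)]
      cov_add_le[OF V dominated_translate[OF g a] IH(1)] IH(2) cov_translate[OF V g a]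
    by (simp add: algebra_simps)
qed

text \<open>Finitely many translates of a multiple of \<open>f0\<close> dominate \<open>f\<close>,
  and their number and the factor do not involve \<open>V\<close>. The resulting bound confines all
  normalised covering numbers to one compact box.\<close>

lemma cov_relative_bound:
  assumes f0: "f0 \<in> Cc" and x0: "x0 \<in> carrier G" "0 < f0 x0" and f: "compactly_dominated f"
  obtains M where "0 \<le> M" "\<And>V. unit_nbhd V \<Longrightarrow> cov V f \<le> M * cov V f0"
proof -
  obtain K N where K: "compactin T K" "0 \<le> N" "\<forall>x\<in>carrier G. f x \<le> N * indicator K x"
    using f unfolding compactly_dominated_def by metis
  define U where "U = {y \<in> topspace T. f0 y \<in> {f0 x0 / 2<..}}"
  have "openin T U"
    unfolding U_def using f0
    by (intro openin_continuous_map_preimage[where Y = euclideanreal]) (auto simp: Cc_def)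
  moreover have "x0 \<in> U" using x0 by (simp add: U_def topspace_carrier)
  ultimately obtain xs where xs: "set xs \<subseteq> carrier G" "\<And>y. y \<in> K \<Longrightarrow> \<exists>x\<in>set xs. inv x \<otimes> y \<in> U"
    using compact_finite_translates[OF K(1)] by metis
  \<comment> \<open>With this factor \<open>d * f0\<close> is at least \<open>N\<close> on
    \<open>U\<close>, where \<open>f0\<close> exceeds half its value at \<open>x0\<close>.\<close>
  define d where "d = 2 * N / f0 x0"
  have d: "0 \<le> d" using K(2) x0 by (simp add: d_def)
  define g where "g y = d * f0 y" for y
  have g: "compactly_dominated g"
    unfolding g_def using Cc_dominated[OF f0] d by (rule dominated_scale)
  have g0: "0 \<le> g y" if "y \<in> carrier G" for y
    using that f0 d by (auto simp: g_def Cc_def)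
  have le: "f y \<le> (\<Sum>x\<leftarrow>xs. g (inv x \<otimes> y))" if y: "y \<in> carrier G" for y
  proof (cases "y \<in> K")
    case True
    then obtain x where x: "x \<in> set xs" "inv x \<otimes> y \<in> U" using xs(2) by blast
    have "f y \<le> N" using K(3) y True by fastforce
    also have "\<dots> = d * (f0 x0 / 2)" using x0 by (simp add: d_def)
    also have "\<dots> \<le> g (inv x \<otimes> y)"
      unfolding g_def using x(2) d by (intro mult_left_mono) (auto simp: U_def)
    also have "\<dots> \<le> (\<Sum>x\<leftarrow>xs. g (inv x \<otimes> y))"
      using x xs(1) y g0 by (intro member_le_sum_list) auto
    finally show ?thesis .
  next
    case False
    then have "f y \<le> 0" using K(3) y by fastforce
    also have "0 \<le> (\<Sum>x\<leftarrow>xs. g (inv x \<otimes> y))"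
      using xs(1) y g0 by (intro sum_list_nonneg) auto
    finally show ?thesis .
  qed
  have "cov V f \<le> (real (length xs) * d) * cov V f0" if V: "unit_nbhd V" for V
  proof -
    have "cov V f \<le> cov V (\<lambda>y. \<Sum>x\<leftarrow>xs. g (inv x \<otimes> y))"
      using cov_sum_translates[OF V g xs(1)] le by (intro cov_mono[OF V]) auto
    also have "\<dots> \<le> real (length xs) * cov V g"
      using cov_sum_translates[OF V g xs(1)] by auto
    also have "cov V g = d * cov V f0"
      unfolding g_def by (rule cov_scale[OF V Cc_dominated[OF f0] d])
    finally show ?thesis by (simp add: algebra_simps)
  qed
  then show ?thesis using that[of "real (length xs) * d"] d by auto
qed

section \<open>Asymptotic additivity of covering numbers\<close>

text \<open>The tube lemma along \<open>K\<close> times the unit gives one neighbourhood that serves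
  all \<open>x\<close> in \<open>K\<close>. The increment \<open>v\<close> stands on the right
  because covers consist of left translates \<open>x V\<close>.\<close>

lemma uniformly_continuous_Cc:
  assumes f: "f \<in> Cc" and d: "0 < d"
  obtains V where "unit_nbhd V"
    "\<And>x v. x \<in> carrier G \<Longrightarrow> v \<in> V \<Longrightarrow> \<bar>f (x \<otimes> v) - f x\<bar> < d"
proof -
  obtain K where fc: "continuous_map T euclideanreal f" and K: "compactin T K"
    and z: "\<forall>x\<in>carrier G - K. f x = 0"
    using assms by (auto simp: Cc_def)
  have Kc: "K \<subseteq> carrier G" using K by (rule compactin_subset_carrier)
  define F where "F p = f (fst p \<otimes> snd p) - f (fst p)" for p
  define W where "W = {p \<in> topspace (prod_topology T T). F p \<in> {-d<..<d}}"
  have c1: "continuous_map (prod_topology T T) euclideanreal (\<lambda>p. f (fst p \<otimes> snd p))"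
    using continuous_map_compose[OF continuous_mult fc] by (simp add: o_def case_prod_unfold)
  have c2: "continuous_map (prod_topology T T) euclideanreal (\<lambda>p. f (fst p))"
    using continuous_map_compose[OF continuous_map_fst fc] by (simp add: o_def)
  have "openin (prod_topology T T) W"
    unfolding W_def
    by (rule openin_continuous_map_preimage[where Y = euclideanreal])
      (auto simp: F_def intro!: continuous_map_diff c1 c2)
  moreover have "K \<times> {\<one>} \<subseteq> W"
    using Kc d by (auto simp: W_def F_def topspace_carrier)
  ultimately obtain A B where AB: "openin T B" "K \<subseteq> A" "\<one> \<in> B" "A \<times> B \<subseteq> W"
    by (elim Wallace_theorem_prod_topology[OF K, of T "{\<one>}" W, rotated]) (auto simp: topspace_carrier)
  have near: "\<bar>f (x \<otimes> v) - f x\<bar> < d" if "x \<in> K" "v \<in> B" for x v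
    using that AB by (fastforce simp: W_def F_def)
  \<comment> \<open>Symmetry handles the case where only \<open>x v\<close> lies in
    \<open>K\<close>: one steps back from \<open>x v\<close> by the inverse of \<open>v\<close>. If
    neither point lies in \<open>K\<close>, both values vanish.\<close>
  define V where "V = B \<inter> {v \<in> topspace T. inv v \<in> B}"
  have "openin T V"
    unfolding V_def using AB(1)
    by (intro openin_Int openin_continuous_map_preimage[OF continuous_inv])
  moreover have "\<one> \<in> V" using AB by (simp add: V_def topspace_carrier)
  moreover have "\<bar>f (x \<otimes> v) - f x\<bar> < d" if x: "x \<in> carrier G" and v: "v \<in> V" for x v
  proof -
    have vc: "v \<in> carrier G" "v \<in> B" "inv v \<in> B"
      using v by (auto simp: V_def topspace_carrier)
    consider "x \<in> K" | "x \<otimes> v \<in> K" | "x \<notin> K" "x \<otimes> v \<notin> K" by blast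
    then show ?thesis
    proof cases
      case 1 then show ?thesis using near vc by blast
    next
      case 2
      have "\<bar>f (x \<otimes> v \<otimes> inv v) - f (x \<otimes> v)\<bar> < d" using near[OF 2 vc(3)] .
      then show ?thesis using x vc by (simp add: m_assoc)
    next
      case 3 then show ?thesis using z x vc d by simp
    qed
  qed
  ultimately show ?thesis using that unfolding unit_nbhd_def by blast
qed

text \<open>The quotients \<open>p = f / (f + g + d)\<close> and \<open>q = g / (f + g + d)\<close> vary by less than \<open>d\<close> on the
  translates of a small \<open>V\<close>, and \<open>f = u p\<close>, \<open>g = u q\<close> for \<open>u = f + g + d 1\<^sub>K\<close>. So a cover of \<open>u\<close>
  splits into covers of \<open>f\<close> and \<open>g\<close> at a small cost.\<close>

lemma cov_almost_additive:
  assumes f0: "f0 \<in> Cc" and x0: "x0 \<in> carrier G" "0 < f0 x0"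
    and f: "f \<in> Cc" and g: "g \<in> Cc" and e: "0 < e"
  obtains W where "unit_nbhd W"
    "\<And>V. unit_nbhd V \<Longrightarrow> V \<subseteq> W \<Longrightarrow> cov V f + cov V g \<le> cov V (\<lambda>x. f x + g x) + e * cov V f0"
proof -
  obtain K1 where fc: "continuous_map T euclideanreal f" and K1: "compactin T K1"
    and z1: "\<forall>x\<in>carrier G - K1. f x = 0" and f_nn: "\<forall>x\<in>carrier G. 0 \<le> f x"
    using f by (auto simp: Cc_def)
  obtain K2 where gc: "continuous_map T euclideanreal g" and K2: "compactin T K2"
    and z2: "\<forall>x\<in>carrier G - K2. g x = 0" and g_nn: "\<forall>x\<in>carrier G. 0 \<le> g x"
    using g by (auto simp: Cc_def)
  define K where "K = K1 \<union> K2"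
  have K: "compactin T K" using K1 K2 by (simp add: K_def compactin_Un)
  have zf: "f x = 0" and zg: "g x = 0" if "x \<in> carrier G" "x \<notin> K" for x
    using that z1 z2 by (auto simp: K_def)
  have domK: "compactly_dominated (indicator K)"
    unfolding compactly_dominated_def using K by (intro exI[of _ K] exI[of _ 1]) auto
  have domfg: "compactly_dominated (\<lambda>x. f x + g x)"
    using f g by (intro dominated_add Cc_dominated)
  obtain N where N: "0 \<le> N" "\<And>V. unit_nbhd V \<Longrightarrow> cov V (indicator K) \<le> N * cov V f0"
    using cov_relative_bound[OF f0 x0 domK] by metis
  obtain M where M: "0 \<le> M" "\<And>V. unit_nbhd V \<Longrightarrow> cov V (\<lambda>x. f x + g x) \<le> M * cov V f0"
    using cov_relative_bound[OF f0 x0 domfg] by metis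
  \<comment> \<open>The final error is at most \<open>2 d M + d N + 2 d d N\<close> times
    \<open>cov V f0\<close>. Since \<open>d\<close> is at most 1, this is bounded by
    \<open>d (2 M + 3 N)\<close> times \<open>cov V f0\<close>.\<close>
  define d where "d = min 1 (e / (2 * M + 3 * N + 1))"
  have d: "0 < d" "d \<le> 1" using e M(1) N(1) by (auto simp: d_def)
  have "d * (2 * M + 3 * N + 1) \<le> e"
  proof -
    have "d \<le> e / (2 * M + 3 * N + 1)" by (simp add: d_def)
    then show ?thesis using M(1) N(1) by (simp add: field_simps)
  qed
  then have de: "d * (2 * M + 3 * N) \<le> e" using d by (simp add: algebra_simps)
  have pos: "0 < f x + g x + d" if "x \<in> carrier G" for x
    using f_nn g_nn that d by (simp add: add_nonneg_pos)
  have p: "(\<lambda>x. k x / (f x + g x + d)) \<in> Cc" if "k \<in> Cc" for k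
  proof -
    have "continuous_map T euclideanreal (\<lambda>x. k x / (f x + g x + d))"
    proof (intro continuous_map_real_divide continuous_map_add fc gc)
      show "continuous_map T euclideanreal k" using that by (simp add: Cc_def)
      show "f x + g x + d \<noteq> 0" if "x \<in> topspace T" for x
        using pos[of x] that topspace_carrier by fastforce
    qed auto
    moreover have "0 \<le> k x / (f x + g x + d)" if "x \<in> carrier G" for x
      using pos[OF that] that \<open>k \<in> Cc\<close> by (auto simp: Cc_def intro!: divide_nonneg_pos)
    moreover have "\<exists>K. compactin T K \<and> (\<forall>x\<in>carrier G - K. k x / (f x + g x + d) = 0)"
      using that by (auto simp: Cc_def)
    ultimately show ?thesis by (simp add: Cc_def)
  qed
  define p where "p x = f x / (f x + g x + d)" for x
  define q where "q x = g x / (f x + g x + d)" for x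
  obtain W1 where W1: "unit_nbhd W1"
    "\<And>x v. x \<in> carrier G \<Longrightarrow> v \<in> W1 \<Longrightarrow> \<bar>p (x \<otimes> v) - p x\<bar> < d"
    using uniformly_continuous_Cc[OF p[OF f] d(1)] unfolding p_def by metis
  obtain W2 where W2: "unit_nbhd W2"
    "\<And>x v. x \<in> carrier G \<Longrightarrow> v \<in> W2 \<Longrightarrow> \<bar>q (x \<otimes> v) - q x\<bar> < d"
    using uniformly_continuous_Cc[OF p[OF g] d(1)] unfolding q_def by metis
  have "unit_nbhd (W1 \<inter> W2)" using W1(1) W2(1) by (auto simp: unit_nbhd_def)
  moreover have "cov V f + cov V g \<le> cov V (\<lambda>x. f x + g x) + e * cov V f0"
    if V: "unit_nbhd V" and VW: "V \<subseteq> W1 \<inter> W2" for V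
  proof -
    \<comment> \<open>On \<open>K\<close> this equals the denominator of \<open>p\<close> and
      \<open>q\<close>; off \<open>K\<close> both \<open>f\<close> and \<open>g\<close> vanish. The
      indicator keeps \<open>u\<close> compactly dominated, which the constant \<open>d\<close>
      would not do in general.\<close>
    define u where "u x = f x + g x + d * indicator K x" for x
    have domu: "compactly_dominated u"
      unfolding u_def using domK d by (intro dominated_add[OF domfg] dominated_scale) auto
    \<comment> \<open>A translate \<open>x V\<close> of weight \<open>c\<close> is reweighted by
      \<open>r x + d\<close>, which bounds \<open>r\<close> on all of \<open>x V\<close>.\<close>
    have split_cover: "cov V k \<le> (\<Sum>(c, x)\<leftarrow>L. c * (r x + d))"
      if L: "is_cover V u L" and r_nn: "\<And>x. x \<in> carrier G \<Longrightarrow> 0 \<le> r x"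
        and kr: "\<And>x. x \<in> carrier G \<Longrightarrow> k x = u x * r x"
        and near: "\<And>x v. x \<in> carrier G \<Longrightarrow> v \<in> V \<Longrightarrow> \<bar>r (x \<otimes> v) - r x\<bar> < d" for k r L
    proof -
      have Lc: "0 \<le> c \<and> x \<in> carrier G" if "(c, x) \<in> set L" for c x
        using L that by (auto simp: is_cover_def)
      define L' where "L' = map (\<lambda>(c, x). (c * (r x + d), x)) L"
      have "k y \<le> cover_val V L' y" if y: "y \<in> carrier G" for y
      proof -
        have "k y \<le> cover_val V L y * r y"
          unfolding kr[OF y] using L y r_nn by (intro mult_right_mono) (auto simp: is_cover_def)
        also have "\<dots> = (\<Sum>(c, x)\<leftarrow>L. c * indicator V (inv x \<otimes> y) * r y)"
          by (simp add: cover_val_def sum_list_mult_const[symmetric] case_prod_unfold)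
        also have "\<dots> \<le> (\<Sum>(c, x)\<leftarrow>L. c * (r x + d) * indicator V (inv x \<otimes> y))"
        proof (rule sum_list_mono, clarify)
          fix c x assume cx: "(c, x) \<in> set L"
          show "c * indicator V (inv x \<otimes> y) * r y \<le> c * (r x + d) * indicator V (inv x \<otimes> y)"
          proof (cases "inv x \<otimes> y \<in> V")
            case True
            have "x \<otimes> (inv x \<otimes> y) = y" using Lc[OF cx] y by (simp add: m_assoc[symmetric])
            then have "r y \<le> r x + d" using near[OF _ True, of x] Lc[OF cx] by fastforce
            then show ?thesis using True Lc[OF cx] by (simp add: mult_left_mono)
          qed simp
        qed
        also have "\<dots> = cover_val V L' y"
          by (simp add: cover_val_def L'_def o_def case_prod_unfold)
        finally show ?thesis .
      qed
      then have "is_cover V k L'"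
        unfolding is_cover_def using Lc r_nn d by (fastforce simp: L'_def)
      then have "cov V k \<le> sum_list (map fst L')" by (rule cov_le)
      then show ?thesis by (simp add: L'_def o_def case_prod_unfold)
    qed
    \<comment> \<open>Since \<open>p + q\<close> is at most 1, the two reweighted covers together
      have total weight at most \<open>1 + 2 * d\<close> times that of \<open>L\<close>.\<close>
    have "(cov V f + cov V g) / (1 + 2 * d) \<le> cov V u"
    proof (rule cov_greatest[OF V domu])
      fix L assume L: "is_cover V u L"
      have fu: "f x = u x * p x" "g x = u x * q x" if x: "x \<in> carrier G" for x
        using pos[OF x] zf[OF x] zg[OF x] by (cases "x \<in> K"; simp add: u_def p_def q_def)+
      have nn: "0 \<le> p x" "0 \<le> q x" "p x + q x \<le> 1" if x: "x \<in> carrier G" for x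
        using pos[OF x] f_nn g_nn x d
        by (auto simp: p_def q_def add_divide_distrib[symmetric] intro!: divide_nonneg_nonneg)
      have "cov V f \<le> (\<Sum>(c, x)\<leftarrow>L. c * (p x + d))"
        using VW by (intro split_cover[OF L]) (auto simp: fu nn W1)
      moreover have "cov V g \<le> (\<Sum>(c, x)\<leftarrow>L. c * (q x + d))"
        using VW by (intro split_cover[OF L]) (auto simp: fu nn W2)
      ultimately have "cov V f + cov V g \<le> (\<Sum>(c, x)\<leftarrow>L. c * (p x + d) + c * (q x + d))"
        by (simp add: case_prod_unfold sum_list_addf)
      also have "\<dots> \<le> (\<Sum>(c, x)\<leftarrow>L. c * (1 + 2 * d))"
      proof (rule sum_list_mono, clarify)
        fix c x assume cx: "(c, x) \<in> set L"
        then have "0 \<le> c" "x \<in> carrier G" using L by (auto simp: is_cover_def)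
        then have "c * ((p x + d) + (q x + d)) \<le> c * (1 + 2 * d)"
          using nn by (intro mult_left_mono) auto
        then show "c * (p x + d) + c * (q x + d) \<le> c * (1 + 2 * d)"
          by (simp add: algebra_simps)
      qed
      also have "\<dots> = sum_list (map fst L) * (1 + 2 * d)"
        by (simp add: case_prod_unfold sum_list_mult_const)
      finally show "(cov V f + cov V g) / (1 + 2 * d) \<le> sum_list (map fst L)"
        using d by (simp add: field_simps)
    qed
    then have "cov V f + cov V g \<le> (1 + 2 * d) * cov V u"
      using d by (simp add: field_simps)
    also have "cov V u \<le> cov V (\<lambda>x. f x + g x) + d * cov V (indicator K)"
      unfolding u_def using cov_add_le[OF V domfg dominated_scale[OF domK]] cov_scale[OF V domK] d
      by simp
    also have "\<dots> \<le> cov V (\<lambda>x. f x + g x) + d * (N * cov V f0)"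
      using N(2)[OF V] d by simp
    finally have *: "cov V f + cov V g \<le> (1 + 2 * d) * (cov V (\<lambda>x. f x + g x) + d * (N * cov V f0))"
      using d by simp
    define c0 where "c0 = cov V f0"
    have c0: "0 \<le> c0" unfolding c0_def by (intro cov_nonneg V Cc_dominated f0)
    have "2 * d * cov V (\<lambda>x. f x + g x) \<le> 2 * d * (M * c0)"
      unfolding c0_def using M(2)[OF V] d by (intro mult_left_mono) auto
    moreover have "d * d * (N * c0) \<le> d * (N * c0)"
      using d N(1) c0 by (intro mult_right_mono mult_left_le) auto
    moreover have "d * (2 * M + 3 * N) * c0 \<le> e * c0"
      using de c0 by (intro mult_right_mono)
    ultimately show ?thesis
      using * unfolding c0_def[symmetric] by (simp add: algebra_simps)
  qed
  ultimately show ?thesis using that by blast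
qed

subsection \<open>The left Haar integral\<close>

lemma Cc_add: "f \<in> Cc \<Longrightarrow> g \<in> Cc \<Longrightarrow> (\<lambda>x. f x + g x) \<in> Cc"
proof -
  assume f: "f \<in> Cc" and g: "g \<in> Cc"
  obtain K L where "compactin T K" "\<forall>x\<in>carrier G - K. f x = 0"
    and "compactin T L" "\<forall>x\<in>carrier G - L. g x = 0"
    using f g by (auto simp: Cc_def)
  then have "\<exists>K. compactin T K \<and> (\<forall>x\<in>carrier G - K. f x + g x = 0)"
    by (intro exI[of _ "K \<union> L"]) (auto simp: compactin_Un)
  then show ?thesis
    using f g by (auto simp: Cc_def intro!: continuous_map_add)
qed

lemma Cc_scale: "f \<in> Cc \<Longrightarrow> 0 \<le> c \<Longrightarrow> (\<lambda>x. c * f x) \<in> Cc"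
  by (fastforce simp: Cc_def intro!: continuous_map_real_mult)

lemma Cc_mult: "f \<in> Cc \<Longrightarrow> g \<in> Cc \<Longrightarrow> (\<lambda>x. f x * g x) \<in> Cc"
  by (fastforce simp: Cc_def intro!: continuous_map_real_mult)

lemma Cc_translate:
  assumes f: "f \<in> Cc" and a: "a \<in> carrier G" and b: "b \<in> carrier G"
  shows "(\<lambda>x. f (a \<otimes> x \<otimes> b)) \<in> Cc"
proof -
  obtain K where fc: "continuous_map T euclideanreal f" and K: "compactin T K"
    and z: "\<forall>x\<in>carrier G - K. f x = 0" and nn: "\<forall>x\<in>carrier G. 0 \<le> f x"
    using f by (auto simp: Cc_def)
  have "continuous_map T T (\<lambda>x. a \<otimes> x \<otimes> b)"
    using a b by (intro continuous_map_mult continuous_map_group_const continuous_map_id[unfolded id_def])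
  from continuous_map_compose[OF this fc] have "continuous_map T euclideanreal (\<lambda>x. f (a \<otimes> x \<otimes> b))"
    by (simp add: o_def)
  moreover have "f (a \<otimes> x \<otimes> b) = 0" if x: "x \<in> carrier G - (\<lambda>x. inv a \<otimes> x \<otimes> inv b) ` K" for x
  proof -
    have "inv a \<otimes> (a \<otimes> x \<otimes> b) \<otimes> inv b = x"
      using x a b by (simp add: m_assoc inv_solve_left')
    then have "a \<otimes> x \<otimes> b \<notin> K" using x by force
    then show ?thesis using z x a b by simp
  qed
  moreover have "compactin T ((\<lambda>x. inv a \<otimes> x \<otimes> inv b) ` K)"
    using K a b by (intro compactin_translate) auto
  ultimately show ?thesis using nn a b unfolding Cc_def by blast
qed

lemma Cc_cong:
  assumes "f \<in> Cc" "\<And>x. x \<in> carrier G \<Longrightarrow> f x = g x"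
  shows "g \<in> Cc"
proof -
  have "continuous_map T euclideanreal g"
  proof (rule continuous_map_eq)
    show "continuous_map T euclideanreal f" using assms(1) by (simp add: Cc_def)
    show "f x = g x" if "x \<in> topspace T" for x
      using assms(2) that topspace_carrier by blast
  qed
  moreover have "\<forall>x\<in>carrier G. 0 \<le> g x"
    using assms unfolding Cc_def by force
  moreover have "\<exists>K. compactin T K \<and> (\<forall>x\<in>carrier G - K. g x = 0)"
    using assms unfolding Cc_def by (smt (verit) DiffE mem_Collect_eq)
  ultimately show ?thesis by (simp add: Cc_def)
qed

lemma Cc_left_translate: "f \<in> Cc \<Longrightarrow> a \<in> carrier G \<Longrightarrow> (\<lambda>x. f (a \<otimes> x)) \<in> Cc"
  using Cc_translate[of f a \<one>] by (rule Cc_cong) auto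

lemma Cc_right_translate: "f \<in> Cc \<Longrightarrow> b \<in> carrier G \<Longrightarrow> (\<lambda>x. f (x \<otimes> b)) \<in> Cc"
  using Cc_translate[of f \<one> b] by (rule Cc_cong) auto

text \<open>The intersection with the whole space gives the right set for empty \<open>A\<close>,
  where the bare intersection is \<open>UNIV\<close>.\<close>

lemma unit_nbhd_Inter:
  assumes "finite A" "\<And>i. i \<in> A \<Longrightarrow> unit_nbhd (W i)"
  shows "unit_nbhd (topspace T \<inter> (\<Inter>i\<in>A. W i))"
proof (cases "A = {}")
  case False
  then have "openin T (\<Inter>(W ` A))"
    using assms by (intro openin_Inter) (auto simp: unit_nbhd_def)
  moreover have "\<one> \<in> topspace T" by (simp add: topspace_carrier)
  ultimately show ?thesis using assms(2) by (auto simp: unit_nbhd_def intro: openin_Int)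
qed (simp add: unit_nbhd_def topspace_carrier[symmetric], simp add: topspace_carrier)

text \<open>In the product topology evaluation at an argument is continuous, and each condition
  involves only finitely many evaluations.\<close>

lemma closed_functional_le:
  fixes f g h :: "'c"
  shows "closed {I :: 'c \<Rightarrow> real. I f \<le> I g}"
    "closed {I :: 'c \<Rightarrow> real. I f \<le> I g + I h}"
    "closed {I :: 'c \<Rightarrow> real. I f + I g \<le> I h + e}"
    "closed {I :: 'c \<Rightarrow> real. I f = c * I g}"
    "closed {I :: 'c \<Rightarrow> real. I f = c}"
  by (intro closed_Collect_le closed_Collect_eq continuous_intros continuous_on_product_coordinates)+

text \<open>A product of compact intervals is compact by Tychonoff's theorem. The integral is found
  as a point of such a box.\<close>

lemma compact_box: "compact {I :: 'c \<Rightarrow> real. \<forall>f. I f \<in> {0..b f}}"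
proof -
  have "compactin (product_topology (\<lambda>i. euclideanreal) UNIV) (PiE UNIV (\<lambda>f. {0..b f}))"
    by (subst compactin_PiE) auto
  then have "compact (PiE UNIV (\<lambda>f. {0..b f}))"
    by (simp add: euclidean_product_topology)
  then show ?thesis by (simp add: PiE_def Pi_def)
qed

text \<open>The integral is encoded as a functional on the cone \<open>Cc\<close> instead of a
  measure. The zero functional is not excluded; nontriviality is supplied separately by a
  normalisation such as \<open>I f0 = 1\<close>.\<close>

definition left_Haar :: "(('a \<Rightarrow> real) \<Rightarrow> real) \<Rightarrow> bool"
  where "left_Haar I \<longleftrightarrow>
    (\<forall>f\<in>Cc. 0 \<le> I f) \<and>
    (\<forall>f\<in>Cc. \<forall>g\<in>Cc. (\<forall>x\<in>carrier G. f x \<le> g x) \<longrightarrow> I f \<le> I g) \<and>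
    (\<forall>f\<in>Cc. \<forall>g\<in>Cc. I (\<lambda>x. f x + g x) = I f + I g) \<and>
    (\<forall>f\<in>Cc. \<forall>c\<ge>0. I (\<lambda>x. c * f x) = c * I f) \<and>
    (\<forall>f\<in>Cc. \<forall>a\<in>carrier G. I (\<lambda>x. f (a \<otimes> x)) = I f)"

text \<open>The set \<open>P\<close> collects the closed conditions that every normalised covering number satisfies;
  the remaining half of additivity, \<open>D\<close>, holds for finitely many data at a time once \<open>V\<close> is small.\<close>

theorem left_Haar_exists:
  assumes f0: "f0 \<in> Cc" and x0: "x0 \<in> carrier G" "0 < f0 x0"
  obtains I where "left_Haar I" "I f0 = 1"
proof -
  have "\<exists>M. \<forall>V. unit_nbhd V \<longrightarrow> cov V f \<le> M * cov V f0" if "f \<in> Cc" for f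
    using cov_relative_bound[OF f0 x0 Cc_dominated[OF that]] by metis
  then obtain b where b: "\<And>f V. f \<in> Cc \<Longrightarrow> unit_nbhd V \<Longrightarrow> cov V f \<le> b f * cov V f0"
    by metis
  have pos: "0 < cov V f0" if "unit_nbhd V" for V
    using cov_ge_value[OF that Cc_dominated[OF f0] x0(1)] x0(2) by simp
  \<comment> \<open>Outside \<open>Cc\<close> the value is pinned to 0, because covering numbers may
    be junk there and compactness needs a bounded interval in every coordinate.\<close>
  define box where "box = {I :: ('a \<Rightarrow> real) \<Rightarrow> real. \<forall>f. I f \<in> {0..(if f \<in> Cc then b f else 0)}}"
  define P where "P =
    (\<Inter>p\<in>{(f, g). f \<in> Cc \<and> g \<in> Cc \<and> (\<forall>x\<in>carrier G. f x \<le> g x)}. {I. I (fst p) \<le> I (snd p)}) \<inter>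
    (\<Inter>p\<in>Cc \<times> Cc. {I. I (\<lambda>x. fst p x + snd p x) \<le> I (fst p) + I (snd p)}) \<inter>
    (\<Inter>p\<in>Cc \<times> {0::real..}. {I. I (\<lambda>x. snd p * fst p x) = snd p * I (fst p)}) \<inter>
    (\<Inter>p\<in>Cc \<times> carrier G. {I. I (\<lambda>x. fst p (snd p \<otimes> x)) = 1 * I (fst p)}) \<inter>
    {I. I f0 = (1::real)}"
  define D where "D p = (case p of (e, f, g) \<Rightarrow> {I. I f + I g \<le> I (\<lambda>x. f x + g x) + e})"
    for p :: "real \<times> ('a \<Rightarrow> real) \<times> ('a \<Rightarrow> real)"
  define Ix where "Ix = {(e::real, f, g). 0 < e \<and> f \<in> Cc \<and> g \<in> Cc}"
  have "closed P"
    unfolding P_def by (intro closed_Int closed_INT ballI closed_functional_le)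
  then have cpt: "compact (box \<inter> P)"
    unfolding box_def by (intro compact_Int_closed compact_box)
  have "(box \<inter> P) \<inter> (\<Inter>p\<in>Ix. D p) \<noteq> {}"
  proof (rule compact_imp_fip_image[OF cpt])
    show "closed (D p)" if "p \<in> Ix" for p
      by (cases p) (simp add: D_def closed_functional_le)
  next
    fix F assume F: "finite F" "F \<subseteq> Ix"
    have W_ex: "\<exists>W. unit_nbhd W \<and> (\<forall>V. unit_nbhd V \<longrightarrow> V \<subseteq> W \<longrightarrow>
        cov V f + cov V g \<le> cov V (\<lambda>x. f x + g x) + e * cov V f0)" if "(e, f, g) \<in> Ix" for e f g
      using cov_almost_additive[OF f0 x0] that unfolding Ix_def by (metis (no_types, lifting) case_prodD mem_Collect_eq)
    have "\<forall>p\<in>Ix. \<exists>W. unit_nbhd W \<and> (\<forall>V. unit_nbhd V \<longrightarrow> V \<subseteq> W \<longrightarrow>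
        cov V (fst (snd p)) + cov V (snd (snd p)) \<le>
        cov V (\<lambda>x. fst (snd p) x + snd (snd p) x) + fst p * cov V f0)"
      (is "\<forall>p\<in>Ix. ?P p")
    proof
      fix p assume "p \<in> Ix"
      then show "?P p" using W_ex[of "fst p" "fst (snd p)" "snd (snd p)"] by simp
    qed
    from bchoice[OF this] obtain W where W': "\<forall>p\<in>Ix. unit_nbhd (W p) \<and>
        (\<forall>V. unit_nbhd V \<longrightarrow> V \<subseteq> W p \<longrightarrow>
          cov V (fst (snd p)) + cov V (snd (snd p)) \<le>
          cov V (\<lambda>x. fst (snd p) x + snd (snd p) x) + fst p * cov V f0)" by (elim exE)
    have W: "unit_nbhd (W p)" if "p \<in> Ix" for p using W' that by blast
    \<comment> \<open>One \<open>V\<close> small enough for the finitely many data in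
      \<open>F\<close> is used, and its normalised covering number is the witness for the finite
      intersection.\<close>
    define V where "V = topspace T \<inter> (\<Inter>p\<in>F. W p)"
    have V: "unit_nbhd V"
      unfolding V_def using F W by (intro unit_nbhd_Inter) auto
    define I where "I f = (if f \<in> Cc then cov V f / cov V f0 else 0)" for f
    have IC: "I f = cov V f / cov V f0" if "f \<in> Cc" for f using that by (simp add: I_def)
    note dom = Cc_dominated
    have "I \<in> box"
      unfolding box_def using b[OF _ V] pos[OF V] cov_nonneg[OF V dom]
      by (auto simp: I_def field_simps)
    moreover have "I \<in> P"
      unfolding P_def using pos[OF V]
      by (auto simp: IC Cc_add Cc_scale Cc_left_translate f0 cov_translate[OF V dom]
          cov_scale[OF V dom] add_divide_distrib[symmetric]
          intro!: divide_right_mono cov_mono[OF V] dom cov_add_le[OF V])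
    moreover have "I \<in> D p" if "p \<in> F" for p
    proof -
      obtain e f g where p: "p = (e, f, g)" by (cases p)
      have fg: "f \<in> Cc" "g \<in> Cc" using that F p by (auto simp: Ix_def)
      have "(cov V f + cov V g) / cov V f0 \<le> (cov V (\<lambda>x. f x + g x) + e * cov V f0) / cov V f0"
        using bspec[OF W', of p] that F V p pos[OF V] by (intro divide_right_mono) (auto simp: V_def)
      then show ?thesis
        using pos[OF V] fg by (simp add: p D_def IC Cc_add add_divide_distrib)
    qed
    ultimately show "box \<inter> P \<inter> (\<Inter>p\<in>F. D p) \<noteq> {}" by blast
  qed
  then obtain I where I: "I \<in> box" "I \<in> P" "\<And>p. p \<in> Ix \<Longrightarrow> I \<in> D p" by blast
  have "I (\<lambda>x. f x + g x) = I f + I g" if fg: "f \<in> Cc" "g \<in> Cc" for f g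
  proof (rule antisym)
    show "I (\<lambda>x. f x + g x) \<le> I f + I g"
      using I(2) fg by (auto simp: P_def)
    show "I f + I g \<le> I (\<lambda>x. f x + g x)"
    proof (rule field_le_epsilon)
      show "I f + I g \<le> I (\<lambda>x. f x + g x) + e" if "0 < e" for e
        using I(3)[of "(e, f, g)"] fg that by (simp add: Ix_def D_def)
    qed
  qed
  moreover have "0 \<le> I f" for f using I(1) by (auto simp: box_def)
  ultimately have "left_Haar I"
    using I(2) unfolding left_Haar_def P_def by auto
  moreover have "I f0 = 1" using I(2) by (auto simp: P_def)
  ultimately show ?thesis using that by blast
qed

section \<open>Calculus of the Haar integral and continuity of convolutions\<close>

lemma Cc_zero: "(\<lambda>x. 0) \<in> Cc"
  by (auto simp: Cc_def intro!: exI[of _ "{}"])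

lemma Haar_mono:
  "left_Haar I \<Longrightarrow> f \<in> Cc \<Longrightarrow> g \<in> Cc \<Longrightarrow> (\<And>x. x \<in> carrier G \<Longrightarrow> f x \<le> g x) \<Longrightarrow> I f \<le> I g"
  by (simp add: left_Haar_def)

lemma Haar_cong:
  assumes "left_Haar I" "f \<in> Cc" "\<And>x. x \<in> carrier G \<Longrightarrow> f x = g x"
  shows "I f = I g"
proof -
  have "g \<in> Cc" using assms(2,3) by (rule Cc_cong)
  then show ?thesis
    using assms(3) by (intro antisym Haar_mono[OF assms(1)] assms(2)) auto
qed

lemma Haar_scale: "left_Haar I \<Longrightarrow> f \<in> Cc \<Longrightarrow> 0 \<le> c \<Longrightarrow> I (\<lambda>x. c * f x) = c * I f"
  by (simp add: left_Haar_def)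

lemma Haar_zero: "left_Haar I \<Longrightarrow> I (\<lambda>x. 0) = 0"
  using Haar_scale[OF _ Cc_zero, of I 0] by simp

lemma Haar_nonneg_sum:
  assumes I: "left_Haar I" and "finite A"
    and "\<And>i. i \<in> A \<Longrightarrow> p i \<in> Cc" "\<And>i. i \<in> A \<Longrightarrow> 0 \<le> c i"
  shows "(\<lambda>x. \<Sum>i\<in>A. c i * p i x) \<in> Cc \<and> I (\<lambda>x. \<Sum>i\<in>A. c i * p i x) = (\<Sum>i\<in>A. c i * I (p i))"
  using assms(2-)
proof (induction A rule: finite_induct)
  case empty
  then show ?case by (simp add: Cc_zero Haar_zero[OF I])
next
  case (insert j A)
  then have IH: "(\<lambda>x. \<Sum>i\<in>A. c i * p i x) \<in> Cc"
    "I (\<lambda>x. \<Sum>i\<in>A. c i * p i x) = (\<Sum>i\<in>A. c i * I (p i))" by auto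
  have j: "(\<lambda>x. c j * p j x) \<in> Cc" using insert by (intro Cc_scale) auto
  have "I (\<lambda>x. c j * p j x) = c j * I (p j)"
    using insert by (intro Haar_scale[OF I]) auto
  moreover have "I (\<lambda>x. c j * p j x + (\<Sum>i\<in>A. c i * p i x)) =
      I (\<lambda>x. c j * p j x) + I (\<lambda>x. \<Sum>i\<in>A. c i * p i x)"
    using I j IH(1) by (simp add: left_Haar_def)
  ultimately show ?case using insert(1,2) Cc_add[OF j IH(1)] IH(2) by simp
qed

text \<open>\<open>I\<close> is additive only on nonnegative functions, so the negative coefficients are moved to the
  other side of the inequality.\<close>

lemma Haar_real_combination_nonneg:
  assumes I: "left_Haar I" and A: "finite A" and p: "\<And>i. i \<in> A \<Longrightarrow> p i \<in> Cc"
    and nn: "\<And>x. x \<in> carrier G \<Longrightarrow> 0 \<le> (\<Sum>i\<in>A. c i * p i x)"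
  shows "0 \<le> (\<Sum>i\<in>A. c i * I (p i))"
proof -
  have c: "c i = max (c i) 0 - max (- c i) 0" for i by simp
  have split: "(\<Sum>i\<in>A. c i * r i) = (\<Sum>i\<in>A. max (c i) 0 * r i) - (\<Sum>i\<in>A. max (- c i) 0 * r i)" for r
    by (subst c) (simp only: left_diff_distrib sum_subtractf)
  note pos = Haar_nonneg_sum[OF I A p, where c = "\<lambda>i. max (c i) 0"]
  note neg = Haar_nonneg_sum[OF I A p, where c = "\<lambda>i. max (- c i) 0"]
  have "I (\<lambda>x. \<Sum>i\<in>A. max (- c i) 0 * p i x) \<le> I (\<lambda>x. \<Sum>i\<in>A. max (c i) 0 * p i x)"
  proof (rule Haar_mono[OF I])
    show "(\<Sum>i\<in>A. max (- c i) 0 * p i x) \<le> (\<Sum>i\<in>A. max (c i) 0 * p i x)" if "x \<in> carrier G" for x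
      using nn[OF that] unfolding split[of "\<lambda>i. p i x"] by simp
  qed (use pos neg in auto)
  then show ?thesis using pos neg by (simp add: split[of "\<lambda>i. I (p i)"])
qed

text \<open>The real version is applied to the real parts of the coefficients and to the imaginary
  parts with both signs. The last two force the imaginary part of the result to vanish.\<close>

lemma Haar_complex_combination_nonneg:
  assumes I: "left_Haar I" and A: "finite A" and p: "\<And>i. i \<in> A \<Longrightarrow> p i \<in> Cc"
    and nn: "\<And>x. x \<in> carrier G \<Longrightarrow> (\<Sum>i\<in>A. c i * complex_of_real (p i x)) \<in> \<real>\<^sub>\<ge>\<^sub>0"
  shows "(\<Sum>i\<in>A. c i * complex_of_real (I (p i))) \<in> \<real>\<^sub>\<ge>\<^sub>0"
proof -
  have "0 \<le> (\<Sum>i\<in>A. Re (c i) * I (p i))"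
    using nn by (intro Haar_real_combination_nonneg[OF I A p]) (simp_all add: complex_nonneg_Reals_iff)
  moreover have "0 \<le> (\<Sum>i\<in>A. Im (c i) * I (p i))"
    using nn by (intro Haar_real_combination_nonneg[OF I A p]) (simp_all add: complex_nonneg_Reals_iff)
  moreover have "0 \<le> (\<Sum>i\<in>A. - Im (c i) * I (p i))"
    using nn by (intro Haar_real_combination_nonneg[OF I A p])
      (simp_all add: complex_nonneg_Reals_iff sum_negf)
  ultimately show ?thesis by (simp add: complex_nonneg_Reals_iff sum_negf)
qed

text \<open>By the tube lemma the factor \<open>h (inv x \<otimes> y \<otimes> s)\<close> varies by
  at most \<open>d\<close> near a given \<open>x\<close>, uniformly for \<open>y\<close> in a
  compact set off which \<open>g\<close> vanishes. So the integrands differ by at most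
  \<open>d * g\<close>.\<close>

lemma Haar_convolution_continuous:
  assumes I: "left_Haar I" and h: "h \<in> Cc" and g: "g \<in> Cc" and s: "s \<in> carrier G"
  shows "continuous_map T euclideanreal (\<lambda>x. I (\<lambda>y. h (inv x \<otimes> y \<otimes> s) * g y))"
proof -
  define q where "q x y = h (inv x \<otimes> y \<otimes> s) * g y" for x y
  have q: "q x \<in> Cc" if "x \<in> carrier G" for x
    unfolding q_def using that by (intro Cc_mult[OF Cc_translate[OF h _ s] g]) auto
  obtain K where K: "compactin T K" and z: "\<forall>x\<in>carrier G - K. g x = 0"
    and g0: "\<forall>x\<in>carrier G. 0 \<le> g x"
    using g by (auto simp: Cc_def)
  have Kc: "K \<subseteq> carrier G" using K by (rule compactin_subset_carrier)
  have hc: "continuous_map T euclideanreal h" using h by (simp add: Cc_def)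
  have Ig: "0 \<le> I g" using I g by (simp add: left_Haar_def)
  have near: "\<exists>U. openin T U \<and> x \<in> U \<and> (\<forall>x'\<in>U. \<bar>I (q x') - I (q x)\<bar> < e)"
    if x: "x \<in> carrier G" and e: "0 < e" for x e
  proof -
    \<comment> \<open>This makes \<open>d * I g\<close> smaller than \<open>e\<close>; the added 1
      covers \<open>I g = 0\<close>.\<close>
    define d where "d = e / (I g + 1)"
    have d: "0 < d" using e Ig by (simp add: d_def)
    have dI: "d * I g < e" using e Ig by (simp add: d_def field_simps)
    define F where "F p = h (inv (fst p) \<otimes> snd p \<otimes> s) - h (inv x \<otimes> snd p \<otimes> s)" for p
    define W where "W = {p \<in> topspace (prod_topology T T). F p \<in> {-d<..<d}}"
    have c1: "continuous_map (prod_topology T T) T (\<lambda>p. inv (fst p) \<otimes> snd p \<otimes> s)"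
      "continuous_map (prod_topology T T) T (\<lambda>p. inv x \<otimes> snd p \<otimes> s)"
      by (intro continuous_map_mult continuous_map_m_inv continuous_map_fst continuous_map_snd
          continuous_map_group_const x s)+
    have "openin (prod_topology T T) W"
      unfolding W_def F_def
      using continuous_map_compose[OF c1(1) hc] continuous_map_compose[OF c1(2) hc]
      by (intro openin_continuous_map_preimage[where Y = euclideanreal] continuous_map_diff)
        (auto simp: o_def)
    moreover have "{x} \<times> K \<subseteq> W"
      using Kc d x by (auto simp: W_def F_def topspace_carrier)
    moreover have "compactin T {x}" using x by (simp add: topspace_carrier)
    ultimately obtain U B where UB: "openin T U" "{x} \<subseteq> U" "K \<subseteq> B" "U \<times> B \<subseteq> W"
      using Wallace_theorem_prod_topology[of T "{x}" T K W] K by metis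
    have "\<bar>I (q x') - I (q x)\<bar> < e" if x': "x' \<in> U" for x'
    proof -
      have x'c: "x' \<in> carrier G"
        using x' UB(1) openin_subset topspace_carrier by blast
      have dg: "(\<lambda>y. d * g y) \<in> Cc" using g d by (intro Cc_scale) auto
      have Idg: "I (\<lambda>y. d * g y) = d * I g" using I g d by (simp add: left_Haar_def)
      have close: "\<bar>q x' y - q x y\<bar> \<le> d * g y" if y: "y \<in> carrier G" for y
      proof (cases "y \<in> K")
        case True
        then have "(x', y) \<in> W" using x' UB by blast
        then have "\<bar>F (x', y)\<bar> \<le> d" by (auto simp: W_def)
        then have "\<bar>F (x', y)\<bar> * g y \<le> d * g y"
          using g0 y by (intro mult_right_mono) auto
        moreover have "q x' y - q x y = F (x', y) * g y"
          by (simp add: q_def F_def left_diff_distrib)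
        ultimately show ?thesis using g0 y by (simp add: abs_mult)
      next
        case False
        then show ?thesis using z y by (simp add: q_def)
      qed
      \<comment> \<open>The bound is one-sided and used twice with \<open>a\<close> and
        \<open>b\<close> exchanged, since the difference of the integrands may leave the cone on
        which \<open>I\<close> is additive.\<close>
      have "I (q a) \<le> I (q b) + d * I g"
        if "a \<in> carrier G" "b \<in> carrier G" "\<And>y. y \<in> carrier G \<Longrightarrow> \<bar>q a y - q b y\<bar> \<le> d * g y" for a b
      proof -
        have "I (q a) \<le> I (\<lambda>y. q b y + d * g y)"
        proof (rule Haar_mono[OF I q[OF that(1)] Cc_add[OF q[OF that(2)] dg]])
          show "q a y \<le> q b y + d * g y" if "y \<in> carrier G" for y
            using \<open>\<And>y. y \<in> carrier G \<Longrightarrow> \<bar>q a y - q b y\<bar> \<le> d * g y\<close>[OF that] by linarith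
        qed
        also have "\<dots> = I (q b) + I (\<lambda>y. d * g y)"
          using I q[OF that(2)] dg by (simp add: left_Haar_def)
        finally show ?thesis using Idg by simp
      qed
      from this[OF x'c x close] this[OF x x'c] close dI show ?thesis
        by (simp add: abs_minus_commute)
    qed
    then show ?thesis using UB by blast
  qed
  have "continuous_map T euclideanreal (\<lambda>x. I (q x))"
    unfolding continuous_map_def
  proof (intro conjI allI impI)
    fix U :: "real set" assume "openin euclideanreal U"
    then have U: "open U" by simp
    show "openin T {x \<in> topspace T. I (q x) \<in> U}"
    proof (subst openin_subopen, intro ballI)
      fix x assume x: "x \<in> {x \<in> topspace T. I (q x) \<in> U}"
      then obtain e where e: "0 < e" "\<And>r. \<bar>r - I (q x)\<bar> < e \<Longrightarrow> r \<in> U"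
        using U unfolding open_dist by (auto simp: dist_real_def)
      obtain N where N: "openin T N" "x \<in> N" "\<forall>x'\<in>N. \<bar>I (q x') - I (q x)\<bar> < e"
        using near[of x e] e x topspace_carrier by auto
      then show "\<exists>N. openin T N \<and> x \<in> N \<and> N \<subseteq> {x \<in> topspace T. I (q x) \<in> U}"
        using e(2) openin_subset[OF N(1)] by (intro exI[of _ N]) auto
    qed
  qed auto
  then show ?thesis unfolding q_def .
qed

section \<open>Bump functions and small neighbourhoods of the unit\<close>

text \<open>Local compactness places an open \<open>U\<close> and a compact \<open>K\<close> between
  the unit and \<open>W\<close>. Complete regularity gives \<open>k\<close> with value 0 at the unit
  and 1 off \<open>U\<close>, and \<open>1 - k\<close> is the bump.\<close>

lemma compact_bump:
  assumes W: "unit_nbhd W"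
  obtains h K where "h \<in> Cc" "h \<one> = 1" "compactin T K" "K \<subseteq> W"
    "\<And>x. x \<in> carrier G \<Longrightarrow> h x \<noteq> 0 \<Longrightarrow> x \<in> K"
proof -
  have "neighbourhood_base_of (compactin T) T"
    using locally_compact_space_neighbourhood_base Hausdorff locally_compact by blast
  then obtain U K where U: "openin T U" "compactin T K" "\<one> \<in> U" "U \<subseteq> K" "K \<subseteq> W"
    using W unfolding neighbourhood_base_of unit_nbhd_def by metis
  have "completely_regular_space T"
    using locally_compact_regular_imp_completely_regular_space Hausdorff locally_compact by blast
  moreover have "closedin T (topspace T - U)" "\<one> \<in> topspace T - (topspace T - U)"
    using U openin_subset[of T U] by (auto intro: closedin_diff)
  ultimately obtain k :: "'a \<Rightarrow> real" where k: "continuous_map T (top_of_set {0..1}) k" "k \<one> = 0"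
    "k ` (topspace T - U) \<subseteq> {1}"
    unfolding completely_regular_space_def by metis
  define h where "h x = 1 - k x" for x
  have k01: "k x \<in> {0..1}" if "x \<in> carrier G" for x
    using k(1) that by (auto simp: continuous_map_in_subtopology topspace_carrier)
  have kc: "continuous_map T euclideanreal k"
    using k(1) by (auto simp: continuous_map_in_subtopology)
  have hK: "x \<in> K" if "x \<in> carrier G" "h x \<noteq> 0" for x
    using that k(3) U(4) by (auto simp: h_def topspace_carrier)
  have "continuous_map T euclideanreal h"
    unfolding h_def using kc by (intro continuous_map_diff) auto
  moreover have "\<forall>x\<in>carrier G. 0 \<le> h x" using k01 by (auto simp: h_def)
  ultimately have "h \<in> Cc"
    unfolding Cc_def using U(2) hK by blast
  then show ?thesis using that[of h K] U hK k(2) by (simp add: h_def)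
qed

lemma unit_nbhd_square:
  assumes c: "continuous_map (prod_topology T T) T c" and D: "openin T D" and e: "c (\<one>, \<one>) \<in> D"
  shows "\<exists>W. unit_nbhd W \<and> (\<forall>x\<in>W. \<forall>y\<in>W. c (x, y) \<in> D)"
proof -
  define S where "S = {p \<in> topspace (prod_topology T T). c p \<in> D}"
  have "openin (prod_topology T T) S"
    unfolding S_def using c D by (rule openin_continuous_map_preimage)
  moreover have "(\<one>, \<one>) \<in> S" using e by (simp add: S_def topspace_carrier)
  ultimately obtain U V where "openin T U" "openin T V" "\<one> \<in> U" "\<one> \<in> V" "U \<times> V \<subseteq> S"
    unfolding openin_prod_topology_alt by metis
  then show ?thesis
    by (intro exI[of _ "U \<inter> V"]) (auto simp: unit_nbhd_def S_def)
qed

subsection \<open>Functions with prescribed values on the powers of an element of finite order\<close>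

lemma int_pow_mod_ord:
  assumes "z \<in> carrier G" "ord z = m"
  shows "z [^] (k mod int m) = z [^] (k::int)"
  using assms by (simp add: int_pow_eq dvd_eq_mod_eq_0 mod_diff_right_eq)

text \<open>Conjugation by \<open>z [^] s\<close> shifts the index of the factors by
  \<open>s\<close> modulo \<open>m\<close> and so permutes them. A product, unlike a sum, keeps the
  support inside that of the factor \<open>l = 0\<close>.\<close>

lemma int_pow_conj_invariant_prod:
  fixes h0 :: "'a \<Rightarrow> real" and s :: int
  assumes z: "z \<in> carrier G" and m: "ord z = m" "m > 0" and x: "x \<in> carrier G"
  defines "h \<equiv> \<lambda>x. \<Prod>l\<in>{0..<int m}. h0 (inv (z [^] l) \<otimes> x \<otimes> z [^] l)"
  shows "h (inv (z [^] s) \<otimes> x \<otimes> z [^] s) = h x"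
proof -
  have "h (inv (z [^] s) \<otimes> x \<otimes> z [^] s) =
      (\<Prod>l\<in>{0..<int m}. h0 (inv (z [^] (s + l)) \<otimes> x \<otimes> z [^] (s + l)))"
    unfolding h_def using z x
    by (intro prod.cong refl) (simp add: int_pow_mult inv_mult_group m_assoc)
  also have "\<dots> = (\<Prod>l\<in>{0..<int m}. h0 (inv (z [^] ((s + l) mod int m)) \<otimes> x \<otimes> z [^] ((s + l) mod int m)))"
    using z m by (simp add: int_pow_mod_ord)
  also have "\<dots> = h x"
    unfolding h_def
    using m(2)
    by (intro prod.reindex_bij_witness[of _ "\<lambda>l. (l - s) mod int m" "\<lambda>l. (s + l) mod int m"])
      (auto simp: mod_simps)
  finally show ?thesis .
qed

text \<open>The empty product is the constant 1, which lies in \<open>Cc\<close> only if the group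
  is compact.\<close>

lemma Cc_prod:
  assumes "finite A" "A \<noteq> {}" "\<And>i. i \<in> A \<Longrightarrow> f i \<in> Cc"
  shows "(\<lambda>x. \<Prod>i\<in>A. f i x) \<in> Cc"
  using assms by (induction A rule: finite_ne_induct) (auto intro: Cc_mult)

text \<open>The first condition keeps the support of the constructed function in
  \<open>\<Omega>\<close>. The second separates the translates of the bump by distinct powers of
  \<open>z\<close>. Each holds near the unit for one exponent, by continuity and by the Hausdorff
  property.\<close>

lemma small_unit_nbhd:
  assumes \<Omega>: "openin T \<Omega>" and z: "z \<in> carrier G" and m: "ord z = m" "m > 0"
  obtains W where "unit_nbhd W"
    "\<And>x y l. x \<in> W \<Longrightarrow> y \<in> W \<Longrightarrow> z [^] l \<in> \<Omega> \<Longrightarrow> x \<otimes> z [^] (l::int) \<otimes> inv y \<in> \<Omega>"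
    "\<And>x y l. x \<in> W \<Longrightarrow> y \<in> W \<Longrightarrow> inv x \<otimes> y = z [^] (l::int) \<Longrightarrow> z [^] l = \<one>"
proof -
  note cont = continuous_map_mult continuous_map_m_inv continuous_map_fst continuous_map_snd
    continuous_map_group_const
  have W1: "\<exists>W. unit_nbhd W \<and> (z [^] l \<in> \<Omega> \<longrightarrow> (\<forall>x\<in>W. \<forall>y\<in>W. x \<otimes> z [^] l \<otimes> inv y \<in> \<Omega>))" for l :: int
  proof (cases "z [^] l \<in> \<Omega>")
    case True
    have "continuous_map (prod_topology T T) T (\<lambda>p. fst p \<otimes> z [^] l \<otimes> inv (snd p))"
      using z by (intro cont) auto
    then show ?thesis
      using unit_nbhd_square[of "\<lambda>p. fst p \<otimes> z [^] l \<otimes> inv (snd p)" \<Omega>] \<Omega> True z by auto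
  next
    case False
    have "unit_nbhd (carrier G)" by (metis openin_topspace topspace_carrier one_closed unit_nbhd_def)
    then show ?thesis using False by blast
  qed
  have W2: "\<exists>W. unit_nbhd W \<and> (z [^] l \<noteq> \<one> \<longrightarrow> (\<forall>x\<in>W. \<forall>y\<in>W. inv x \<otimes> y \<noteq> z [^] l))" for l :: int
  proof (cases "z [^] l = \<one>")
    case False
    have "continuous_map (prod_topology T T) T (\<lambda>p. inv (fst p) \<otimes> snd p)"
      by (intro cont)
    moreover have "closedin T {z [^] l}"
      using Hausdorff z by (intro closedin_Hausdorff_singleton) (auto simp: topspace_carrier)
    then have "openin T (topspace T - {z [^] l})" by blast
    moreover have "inv \<one> \<otimes> \<one> \<in> topspace T - {z [^] l}"
      using False by (auto simp: topspace_carrier)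
    ultimately show ?thesis
      using unit_nbhd_square[of "\<lambda>p. inv (fst p) \<otimes> snd p" "topspace T - {z [^] l}"] by auto
  next
    case True
    have "unit_nbhd (carrier G)" by (metis openin_topspace topspace_carrier one_closed unit_nbhd_def)
    then show ?thesis using True by blast
  qed
  obtain A where A: "\<And>l. unit_nbhd (A l)"
    "\<And>l x y. z [^] l \<in> \<Omega> \<Longrightarrow> x \<in> A l \<Longrightarrow> y \<in> A l \<Longrightarrow> x \<otimes> z [^] (l::int) \<otimes> inv y \<in> \<Omega>"
    using W1 by metis
  obtain B where B: "\<And>l. unit_nbhd (B l)"
    "\<And>l x y. z [^] l \<noteq> \<one> \<Longrightarrow> x \<in> B l \<Longrightarrow> y \<in> B l \<Longrightarrow> inv x \<otimes> y \<noteq> z [^] (l::int)"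
    using W2 by metis
  \<comment> \<open>Finite order enters here: finitely many exponents represent all
    integers.\<close>
  define W where "W = topspace T \<inter> (\<Inter>l\<in>{0..<int m}. A l \<inter> B l)"
  have "unit_nbhd (A l \<inter> B l)" for l
    using A(1)[of l] B(1)[of l] by (auto simp: unit_nbhd_def)
  then have "unit_nbhd W"
    unfolding W_def by (intro unit_nbhd_Inter) auto
  moreover have red: "z [^] l = z [^] (l mod int m)" "l mod int m \<in> {0..<int m}" for l :: int
    using int_pow_mod_ord[OF z m(1)] m(2) by auto
  moreover have "x \<otimes> z [^] l \<otimes> inv y \<in> \<Omega>" if "x \<in> W" "y \<in> W" "z [^] l \<in> \<Omega>" for x y and l :: int
    using A(2)[of "l mod int m" x y] that red[of l] by (auto simp: W_def)
  moreover have "z [^] l = \<one>" if "x \<in> W" "y \<in> W" "inv x \<otimes> y = z [^] l" for x y and l :: int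
    using B(2)[of "l mod int m" x y] that red[of l] by (auto simp: W_def)
  ultimately show ?thesis using that by blast
qed

section \<open>Transfer of functions from the cyclic group to the whole group\<close>

text \<open>This is a matrix coefficient of left translation: the left translates by
  \<open>x\<close> of the functions \<open>h (y z\<^sup>b)\<close> are paired with the functions
  \<open>h (y z\<^sup>a)\<close> through the kernel \<open>\<phi> (b - a)\<close>. The argument is
  reduced because \<open>\<phi>\<close> is constrained only on representatives.\<close>

definition smear :: "(('a \<Rightarrow> real) \<Rightarrow> real) \<Rightarrow> ('a \<Rightarrow> real) \<Rightarrow> 'a \<Rightarrow> nat \<Rightarrow> (int \<Rightarrow> complex) \<Rightarrow> 'a \<Rightarrow> complex"
  where "smear I h z m \<phi> x = (\<Sum>a\<in>{0..<int m}. \<Sum>b\<in>{0..<int m}. \<phi> ((b - a) mod int m) *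
    complex_of_real (I (\<lambda>y. h (inv x \<otimes> y \<otimes> z [^] b) * h (y \<otimes> z [^] a))))"

text \<open>Left invariance with \<open>y = x j \<otimes> w\<close> turns the entry for
  \<open>(j, k)\<close> into integrals of \<open>h (x k w z\<^sup>b) h (x j w z\<^sup>a)\<close>.
  The whole quadratic form is then the integral of a function of \<open>w\<close> whose values are
  quadratic forms of \<open>\<phi>\<close>.\<close>

lemma smear_positive_definite:
  assumes I: "left_Haar I" and h: "h \<in> Cc" and z: "z \<in> carrier G" and m: "m > 0"
    and \<phi>: "positive_definite (integer_mod_group m) \<phi>"
  shows "positive_definite G (smear I h z m \<phi>)"
  unfolding positive_definite_def
proof (intro allI impI)
  fix n :: nat and x :: "nat \<Rightarrow> 'a" and c :: "nat \<Rightarrow> complex"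
  assume x: "\<forall>j<n. x j \<in> carrier G"
  let ?Z = "{0..<int m}"
  define H where "H j a w = h (x j \<otimes> w \<otimes> z [^] a)" for j and a :: int and w
  have H: "H j a \<in> Cc" if "j < n" for j a
    unfolding H_def using x that z by (intro Cc_translate[OF h]) auto
  have inv_shift: "I (\<lambda>y. h (inv (x j \<otimes> inv (x k)) \<otimes> y \<otimes> z [^] b) * h (y \<otimes> z [^] a)) =
      I (\<lambda>w. H k b w * H j a w)" if jk: "j < n" "k < n" for j k and a b :: int
  proof -
    define q where "q y = h (inv (x j \<otimes> inv (x k)) \<otimes> y \<otimes> z [^] b) * h (y \<otimes> z [^] a)" for y
    have xc: "x j \<in> carrier G" "x k \<in> carrier G" using x jk by auto
    have q: "q \<in> Cc"
      unfolding q_def using xc z by (intro Cc_mult Cc_translate[OF h] Cc_right_translate[OF h]) auto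
    have "I q = I (\<lambda>w. q (x j \<otimes> w))"
      using I q xc by (simp add: left_Haar_def)
    also have "\<dots> = I (\<lambda>w. H k b w * H j a w)"
    proof (rule Haar_cong[OF I Cc_left_translate[OF q xc(1)]])
      fix w assume w: "w \<in> carrier G"
      have "inv (x j \<otimes> inv (x k)) \<otimes> (x j \<otimes> w) = x k \<otimes> w"
        using xc w by (simp add: inv_mult_group m_assoc) (simp add: m_assoc[symmetric])
      then show "q (x j \<otimes> w) = H k b w * H j a w"
        by (simp add: q_def H_def)
    qed
    finally show ?thesis unfolding q_def .
  qed
  \<comment> \<open>The four summations are merged into one, with complex coefficients
    \<open>d\<close> and real integrands \<open>P\<close>.\<close>
  define A where "A = ({..<n} \<times> {..<n}) \<times> (?Z \<times> ?Z)"
  define d where "d p = (case p of ((j, k), (a, b)) \<Rightarrow> c j * cnj (c k) * \<phi> ((b - a) mod int m))" for p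
  define P where "P p = (case p of ((j, k), (a, b)) \<Rightarrow> \<lambda>w. H k b w * H j a w)" for p
  have "(\<Sum>p\<in>A. d p * complex_of_real (I (P p))) \<in> \<real>\<^sub>\<ge>\<^sub>0"
  proof (rule Haar_complex_combination_nonneg[OF I])
    show "finite A" by (simp add: A_def)
    show "P p \<in> Cc" if "p \<in> A" for p
      using that by (auto simp: A_def P_def intro!: Cc_mult H)
    fix w assume "w \<in> carrier G"
    define C where "C a = (\<Sum>j<n. c j * complex_of_real (H j a w))" for a
    define t where "t j k a b = c j * cnj (c k) * \<phi> ((b - a) mod int m) *
        complex_of_real (H k b w * H j a w)" for j k a b
    have "(\<Sum>p\<in>A. d p * complex_of_real (P p w)) = (\<Sum>j<n. \<Sum>k<n. \<Sum>a\<in>?Z. \<Sum>b\<in>?Z. t j k a b)"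
      by (simp add: A_def d_def P_def t_def sum.cartesian_product')
    also have "\<dots> = (\<Sum>j<n. \<Sum>b\<in>?Z. \<Sum>a\<in>?Z. \<Sum>k<n. t j k a b)"
      by (intro sum.cong refl sum_swap3)
    also have "\<dots> = (\<Sum>b\<in>?Z. \<Sum>a\<in>?Z. \<Sum>j<n. \<Sum>k<n. t j k a b)"
      by (subst sum_swap3) (rule sum.swap)
    \<comment> \<open>The kernel has argument \<open>b - a\<close>, so \<open>b\<close> plays the
      first index and the weights are the conjugates of \<open>C\<close>.\<close>
    also have "\<dots> = (\<Sum>b\<in>?Z. \<Sum>a\<in>?Z. cnj (C b) * cnj (cnj (C a)) * \<phi> ((b - a) mod int m))"
    proof (intro sum.cong refl)
      fix a b
      have "C a * cnj (C b) =
          (\<Sum>j<n. \<Sum>k<n. (c j * complex_of_real (H j a w)) * (cnj (c k) * complex_of_real (H k b w)))"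
        by (simp add: C_def sum_product)
      then show "(\<Sum>j<n. \<Sum>k<n. t j k a b) = cnj (C b) * cnj (cnj (C a)) * \<phi> ((b - a) mod int m)"
        by (simp add: t_def sum_distrib_left mult_ac)
    qed
    also have "\<dots> \<in> \<real>\<^sub>\<ge>\<^sub>0"
      using \<phi> m by (rule positive_definite_cyclic_sum)
    finally show "(\<Sum>p\<in>A. d p * complex_of_real (P p w)) \<in> \<real>\<^sub>\<ge>\<^sub>0" .
  qed
  also have "(\<Sum>p\<in>A. d p * complex_of_real (I (P p))) =
      (\<Sum>j<n. \<Sum>k<n. c j * cnj (c k) * smear I h z m \<phi> (x j \<otimes> inv (x k)))"
    by (simp add: A_def d_def P_def sum.cartesian_product' smear_def inv_shift
        sum_distrib_left mult.assoc)
  finally show "(\<Sum>j<n. \<Sum>k<n. c j * cnj (c k) * smear I h z m \<phi> (x j \<otimes> inv (x k))) \<in> \<real>\<^sub>\<ge>\<^sub>0" .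
qed

lemma smear_continuous:
  assumes I: "left_Haar I" and h: "h \<in> Cc" and z: "z \<in> carrier G"
  shows "continuous_map T euclidean (smear I h z m \<phi>)"
proof -
  have "continuous_map T euclidean (\<lambda>x. \<phi> ((b - a) mod int m) *
    complex_of_real (I (\<lambda>y. h (inv x \<otimes> y \<otimes> z [^] b) * h (y \<otimes> z [^] a))))" for a b :: int
  proof -
    have 1: "continuous_map T euclideanreal (\<lambda>x. I (\<lambda>y. h (inv x \<otimes> y \<otimes> z [^] b) * h (y \<otimes> z [^] a)))"
      using z by (intro Haar_convolution_continuous[OF I h Cc_right_translate[OF h]]) auto
    have 2: "continuous_map euclideanreal euclidean (\<lambda>r. \<phi> ((b - a) mod int m) * complex_of_real r)"
      by (simp add: continuous_map_iff_continuous2 continuous_intros)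
    show ?thesis using continuous_map_compose[OF 1 2] by (simp add: o_def)
  qed
  then have "continuous_map T euclidean (\<lambda>x. smear I h z m \<phi> x)"
    unfolding smear_def by (intro continuous_map_sum) auto
  then show ?thesis by simp
qed

text \<open>Some summand has a nonzero integrand at some \<open>y\<close>. Then
  \<open>k1 = y z\<^sup>a\<close> and \<open>k2 = x\<inverse> y z\<^sup>b\<close> lie in
  \<open>K\<close>, and eliminating \<open>y\<close> gives the factorisation of
  \<open>x\<close>.\<close>

lemma smear_support:
  assumes I: "left_Haar I" and z: "z \<in> carrier G" and m: "ord z = m" "m > 0"
    and hK: "\<And>x. x \<in> carrier G \<Longrightarrow> h x \<noteq> 0 \<Longrightarrow> x \<in> K"
    and x: "x \<in> carrier G" and nz: "smear I h z m \<phi> x \<noteq> 0"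
  obtains k1 k2 l where "k1 \<in> K" "k2 \<in> K" "l \<in> {0..<int m}" "\<phi> l \<noteq> 0"
    "x = k1 \<otimes> z [^] l \<otimes> inv k2"
proof -
  obtain a b where ab: "\<phi> ((b - a) mod int m) *
      complex_of_real (I (\<lambda>y. h (inv x \<otimes> y \<otimes> z [^] b) * h (y \<otimes> z [^] a))) \<noteq> 0"
    using nz unfolding smear_def by (metis (no_types, lifting) sum.neutral)
  define q where "q = (\<lambda>y. h (inv x \<otimes> y \<otimes> z [^] b) * h (y \<otimes> z [^] a))"
  have "I q \<noteq> 0" using ab by (auto simp: q_def)
  have "\<exists>y\<in>carrier G. q y \<noteq> 0"
  proof (rule ccontr)
    assume "\<not> ?thesis"
    then have "I (\<lambda>x. 0) = I q" by (intro Haar_cong[OF I Cc_zero]) auto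
    then show False using \<open>I q \<noteq> 0\<close> Haar_zero[OF I] by simp
  qed
  then obtain y where y: "y \<in> carrier G" "q y \<noteq> 0" by blast
  define k1 where "k1 = y \<otimes> z [^] a"
  define k2 where "k2 = inv x \<otimes> y \<otimes> z [^] b"
  have "k1 \<in> K" "k2 \<in> K"
    unfolding k1_def k2_def using y x z by (intro hK; auto simp: q_def)+
  moreover have "x = k1 \<otimes> z [^] ((b - a) mod int m) \<otimes> inv k2"
  proof -
    have "k1 \<otimes> z [^] ((b - a) mod int m) \<otimes> inv k2 =
        y \<otimes> (z [^] a \<otimes> z [^] (b - a)) \<otimes> inv (z [^] b) \<otimes> inv y \<otimes> x"
      using x y z int_pow_mod_ord[OF z m(1)]
      by (simp add: k1_def k2_def inv_mult_group m_assoc)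
    also have "z [^] a \<otimes> z [^] (b - a) = z [^] b"
      using z int_pow_mult[of z a "b - a"] by simp
    also have "y \<otimes> z [^] b \<otimes> inv (z [^] b) \<otimes> inv y \<otimes> x = x"
      using x y z by (simp add: m_assoc)
    finally show ?thesis by simp
  qed
  ultimately show ?thesis using that[of k1 k2 "(b - a) mod int m"] ab m(2) by auto
qed

text \<open>Conjugation invariance rewrites the first factor as
  \<open>h (y z\<^sup>b\<^sup>-\<^sup>s)\<close>. By the condition on \<open>K\<close> its product
  with \<open>h (y z\<^sup>a)\<close> vanishes unless \<open>b = a + s\<close> modulo
  \<open>m\<close>, and these surviving terms all carry the same coefficient
  \<open>\<phi> (s mod m)\<close>.\<close>

lemma smear_power:
  fixes s :: int
  assumes I: "left_Haar I" and h: "h \<in> Cc" and z: "z \<in> carrier G" and m: "ord z = m" "m > 0"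
    and hK: "\<And>x. x \<in> carrier G \<Longrightarrow> h x \<noteq> 0 \<Longrightarrow> x \<in> K"
    and conj: "\<And>x s. x \<in> carrier G \<Longrightarrow> h (inv (z [^] (s::int)) \<otimes> x \<otimes> z [^] s) = h x"
    and K: "\<And>x y l. x \<in> K \<Longrightarrow> y \<in> K \<Longrightarrow> inv x \<otimes> y = z [^] (l::int) \<Longrightarrow> z [^] l = \<one>"
  shows "smear I h z m \<phi> (z [^] s) = \<phi> (s mod int m) *
    complex_of_real (\<Sum>a\<in>{0..<int m}. I (\<lambda>y. h (y \<otimes> z [^] a) * h (y \<otimes> z [^] a)))"
proof -
  let ?Z = "{0..<int m}"
  define J where "J a = I (\<lambda>y. h (y \<otimes> z [^] a) * h (y \<otimes> z [^] a))" for a :: int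
  have q: "(\<lambda>y. h (inv (z [^] s) \<otimes> y \<otimes> z [^] b) * h (y \<otimes> z [^] a)) \<in> Cc" for a b :: int
    using z by (intro Cc_mult Cc_translate[OF h] Cc_right_translate[OF h]) auto
  have val: "I (\<lambda>y. h (inv (z [^] s) \<otimes> y \<otimes> z [^] b) * h (y \<otimes> z [^] a)) =
      (if b = (a + s) mod int m then J a else 0)" if ab: "a \<in> ?Z" "b \<in> ?Z" for a b
  proof -
    have move: "h (inv (z [^] s) \<otimes> y \<otimes> z [^] b) = h (y \<otimes> z [^] (b - s))" if y: "y \<in> carrier G" for y
    proof -
      have "inv (z [^] s) \<otimes> y \<otimes> z [^] b = inv (z [^] s) \<otimes> (y \<otimes> z [^] (b - s)) \<otimes> z [^] s"
        using y z int_pow_mult[of z "b - s" s] by (simp add: m_assoc)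
      then show ?thesis using conj[of "y \<otimes> z [^] (b - s)" s] y z by simp
    qed
    have eq: "b = (a + s) mod int m \<longleftrightarrow> z [^] (b - s) = z [^] a"
    proof -
      have "z [^] (b - s) = z [^] a \<longleftrightarrow> int m dvd a + s - b"
        using z m(1) by (simp add: int_pow_eq algebra_simps)
      also have "\<dots> \<longleftrightarrow> (a + s) mod int m = b mod int m"
        by (simp add: mod_eq_dvd_iff)
      also have "\<dots> \<longleftrightarrow> b = (a + s) mod int m" using ab(2) by auto
      finally show ?thesis by simp
    qed
    show ?thesis
    proof (cases "b = (a + s) mod int m")
      case True
      then have "I (\<lambda>y. h (inv (z [^] s) \<otimes> y \<otimes> z [^] b) * h (y \<otimes> z [^] a)) = J a"
        unfolding J_def using move eq by (intro Haar_cong[OF I q]) auto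
      then show ?thesis using True by simp
    next
      case False
      have "h (y \<otimes> z [^] (b - s)) * h (y \<otimes> z [^] a) = 0" if y: "y \<in> carrier G" for y
      proof (rule ccontr)
        assume "h (y \<otimes> z [^] (b - s)) * h (y \<otimes> z [^] a) \<noteq> 0"
        then have "y \<otimes> z [^] (b - s) \<in> K" "y \<otimes> z [^] a \<in> K"
          using hK y z by auto
        moreover have "inv (y \<otimes> z [^] (b - s)) \<otimes> (y \<otimes> z [^] a) = inv (z [^] (b - s)) \<otimes> z [^] a"
          using y z by (simp add: inv_mult_group m_assoc) (simp add: m_assoc[symmetric])
        moreover have *: "inv (z [^] (b - s)) \<otimes> z [^] a = z [^] (a - (b - s))"
          using z int_pow_neg[of z "b - s"] int_pow_mult[of z "- (b - s)" a] by (simp add: algebra_simps)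
        ultimately have "inv (z [^] (b - s)) \<otimes> z [^] a = \<one>" using K by metis
        then have "z [^] (b - s) = z [^] a"
          using z by (metis int_pow_closed inv_closed inv_equality inv_inv)
        then show False using False eq by simp
      qed
      then have "I (\<lambda>y. h (inv (z [^] s) \<otimes> y \<otimes> z [^] b) * h (y \<otimes> z [^] a)) = I (\<lambda>x. 0)"
        using move by (intro Haar_cong[OF I q]) auto
      then show ?thesis using False Haar_zero[OF I] by simp
    qed
  qed
  have "smear I h z m \<phi> (z [^] s) =
      (\<Sum>a\<in>?Z. \<Sum>b\<in>?Z. if b = (a + s) mod int m then \<phi> ((b - a) mod int m) * complex_of_real (J a) else 0)"
    unfolding smear_def using val by (intro sum.cong refl) auto
  also have "\<dots> = (\<Sum>a\<in>?Z. \<phi> (s mod int m) * complex_of_real (J a))"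
    using m(2) by (intro sum.cong refl) (simp add: mod_simps)
  finally show ?thesis by (simp add: J_def sum_distrib_left)
qed

theorem cyclic_extension:
  assumes \<Omega>: "openin T \<Omega>" and z: "z \<in> carrier G" and m: "ord z = m" "m > 0"
    and \<phi>: "\<phi> \<in> F_cyclic m (power_indices G m \<Omega> z)"
  obtains f where "f \<in> F_cont G T \<Omega>" "f z = \<phi> (1 mod int m)"
    "\<phi> \<in> real_valued (integer_mod_group m) \<Longrightarrow> f \<in> real_valued G"
proof -
  let ?Z = "{0..<int m}"
  have carZ: "carrier (integer_mod_group m) = ?Z" using m by (simp add: carrier_integer_mod_group)
  have \<phi>_pd: "positive_definite (integer_mod_group m) \<phi>" and \<phi>0: "\<phi> 0 = 1"
    and \<phi>H: "\<And>l. l \<in> ?Z \<Longrightarrow> \<phi> l \<noteq> 0 \<Longrightarrow> z [^] l \<in> \<Omega>"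
    using \<phi> by (auto simp: F_cyclic_def power_indices_def carZ)
  obtain W where W: "unit_nbhd W"
    "\<And>x y l. x \<in> W \<Longrightarrow> y \<in> W \<Longrightarrow> z [^] l \<in> \<Omega> \<Longrightarrow> x \<otimes> z [^] (l::int) \<otimes> inv y \<in> \<Omega>"
    "\<And>x y l. x \<in> W \<Longrightarrow> y \<in> W \<Longrightarrow> inv x \<otimes> y = z [^] (l::int) \<Longrightarrow> z [^] l = \<one>"
    using small_unit_nbhd[OF \<Omega> z m] by metis
  obtain h0 K where h0: "h0 \<in> Cc" "h0 \<one> = 1" and K: "compactin T K" "K \<subseteq> W"
    and h0K: "\<And>x. x \<in> carrier G \<Longrightarrow> h0 x \<noteq> 0 \<Longrightarrow> x \<in> K"
    using compact_bump[OF W(1)] by metis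
  have Kc: "K \<subseteq> carrier G" using K(1) by (rule compactin_subset_carrier)
  define h where "h x = (\<Prod>l\<in>?Z. h0 (inv (z [^] l) \<otimes> x \<otimes> z [^] l))" for x
  have h: "h \<in> Cc"
    unfolding h_def using z m(2) by (intro Cc_prod Cc_translate h0) auto
  have h1: "h \<one> = 1" using z h0(2) by (simp add: h_def)
  have hK: "x \<in> K" if "x \<in> carrier G" "h x \<noteq> 0" for x
  proof -
    \<comment> \<open>The factor with \<open>l = 0\<close> is \<open>h0 x\<close> itself.\<close>
    have "h0 (inv (z [^] (0::int)) \<otimes> x \<otimes> z [^] (0::int)) \<noteq> 0"
      using that(2) m(2) unfolding h_def by (force simp: prod_zero_iff)
    then show ?thesis using h0K that(1) by simp
  qed
  have conj: "h (inv (z [^] s) \<otimes> x \<otimes> z [^] s) = h x" if "x \<in> carrier G" for x and s :: int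
    unfolding h_def using int_pow_conj_invariant_prod[OF z m that, of h0 s] by simp
  obtain I where I: "left_Haar I" "I (\<lambda>x. h x * h x) = 1"
    using left_Haar_exists[OF Cc_mult[OF h h] one_closed] h1 by auto
  define N where "N = (\<Sum>a\<in>?Z. I (\<lambda>y. h (y \<otimes> z [^] a) * h (y \<otimes> z [^] a)))"
  \<comment> \<open>The normalisation of \<open>I\<close> on the square of \<open>h\<close> makes
    the term \<open>a = 0\<close> of \<open>N\<close> equal to 1; the other terms are
    nonnegative.\<close>
  have "I (\<lambda>y. h (y \<otimes> z [^] (0::int)) * h (y \<otimes> z [^] (0::int))) = 1"
    using I(2) Haar_cong[OF I(1) Cc_mult[OF h h], of "\<lambda>y. h (y \<otimes> z [^] (0::int)) * h (y \<otimes> z [^] (0::int))"]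
    by simp
  moreover have "I (\<lambda>y. h (y \<otimes> z [^] (0::int)) * h (y \<otimes> z [^] (0::int))) \<le> N"
    unfolding N_def
  proof (rule member_le_sum)
    show "0 \<le> I (\<lambda>y. h (y \<otimes> z [^] a) * h (y \<otimes> z [^] a))" for a :: int
      using I(1) Cc_mult[OF Cc_right_translate[OF h] Cc_right_translate[OF h]] z
      by (simp add: left_Haar_def)
  qed (use m(2) in auto)
  ultimately have N: "0 < N" by simp
  define f where "f = (\<lambda>x. complex_of_real (1 / N) * smear I h z m \<phi> x)"
  have f_pow: "f (z [^] s) = \<phi> (s mod int m)" for s :: int
  proof -
    have "smear I h z m \<phi> (z [^] s) = \<phi> (s mod int m) * complex_of_real N"
      unfolding N_def using K(2) W(3) by (intro smear_power[OF I(1) h z m hK conj]) blast+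
    then show ?thesis using N by (simp add: f_def)
  qed
  have pd: "positive_definite G f"
    unfolding f_def using N
    by (intro positive_definite_scale smear_positive_definite[OF I(1) h z m(2) \<phi>_pd]) auto
  have cont: "continuous_map T euclidean f"
  proof -
    have "continuous_map euclidean euclidean (\<lambda>w. complex_of_real (1 / N) * w)"
      unfolding continuous_map_iff_continuous2 by (intro continuous_intros)
    from continuous_map_compose[OF smear_continuous[OF I(1) h z] this]
    show ?thesis by (simp add: f_def o_def)
  qed
  \<comment> \<open>As a finite union of compact sets in a Hausdorff space this is closed, so it
    contains the closed support and not merely the nonvanishing set.\<close>
  define S where "S = (\<Union>l\<in>{l\<in>?Z. \<phi> l \<noteq> 0}. (\<lambda>p. fst p \<otimes> z [^] l \<otimes> inv (snd p)) ` (K \<times> K))"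
  have Sc: "compactin T S"
    unfolding S_def
  proof (rule compactin_Union, safe)
    fix l :: int
    show "compactin T ((\<lambda>p. fst p \<otimes> z [^] l \<otimes> inv (snd p)) ` (K \<times> K))"
      using z K(1)
      by (intro image_compactin[of "prod_topology T T"] continuous_map_mult continuous_map_m_inv
          continuous_map_fst continuous_map_snd continuous_map_group_const)
        (auto simp: compactin_Times)
  qed (rule finite_imageI, rule finite_subset[of _ ?Z], auto)
  have S\<Omega>: "S \<subseteq> \<Omega>" unfolding S_def using K(2) W(2) \<phi>H by fastforce
  have "{x \<in> topspace T. f x \<noteq> 0} \<subseteq> S"
  proof clarify
    fix x assume "x \<in> topspace T" "f x \<noteq> 0"
    then have x: "x \<in> carrier G" "smear I h z m \<phi> x \<noteq> 0"
      by (auto simp: topspace_carrier f_def)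
    obtain k1 k2 l where "k1 \<in> K" "k2 \<in> K" "l \<in> ?Z" "\<phi> l \<noteq> 0" "x = k1 \<otimes> z [^] l \<otimes> inv k2"
      using smear_support[OF I(1) z m hK x] by blast
    then show "x \<in> S"
      unfolding S_def by (intro UN_I[of l] image_eqI[of _ _ "(k1, k2)"]) auto
  qed
  moreover have "closedin T S" using Hausdorff Sc by (rule compactin_imp_closedin)
  ultimately have supp: "closed_support T f \<subseteq> S"
    unfolding closed_support_def by (rule closure_of_minimal)
  have "compactin T (closed_support T f)"
    using Sc supp by (rule closed_compactin) (simp add: closed_support_def)
  moreover have "f \<one> = 1" using f_pow[of 0] \<phi>0 by simp
  ultimately have "f \<in> F_cont G T \<Omega>"
    using pd cont supp S\<Omega> by (auto simp: F_cont_def)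
  moreover have "f z = \<phi> (1 mod int m)" using f_pow[of 1] z by simp
  moreover have "f \<in> real_valued G" if "\<phi> \<in> real_valued (integer_mod_group m)"
  proof -
    have "\<phi> ((b - a) mod int m) \<in> \<real>" for a b
      using that m(2) by (simp add: real_valued_def carZ)
    then show ?thesis
      unfolding real_valued_def f_def smear_def by (auto intro!: Reals_mult sum_in_Reals)
  qed
  ultimately show ?thesis using that by blast
qed

section \<open>Comparison of the function classes and of the extremal constants\<close>

lemma F_cont_subset_F_sharp: "F_cont G T \<Omega> \<subseteq> F_sharp G \<Omega>"
proof
  fix f assume f: "f \<in> F_cont G T \<Omega>"
  have "{x \<in> topspace T. f x \<noteq> 0} \<subseteq> closed_support T f"
    unfolding closed_support_def by (intro closure_of_subset) auto
  then have "f x = 0" if "x \<in> carrier G - \<Omega>" for x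
    using that f by (auto simp: F_cont_def topspace_carrier)
  then show "f \<in> F_sharp G \<Omega>" using f by (simp add: F_cont_def F_sharp_def)
qed

text \<open>The map sending \<open>k\<close> to \<open>z [^] k\<close> is a homomorphism from the
  cyclic group, and positive definiteness pulls back along homomorphisms.\<close>

lemma F_sharp_restrict_cyclic:
  assumes z: "z \<in> carrier G" and m: "ord z = m" "m > 0" and f: "f \<in> F_sharp G \<Omega>"
  shows "(\<lambda>k. f (z [^] k)) \<in> F_cyclic m (power_indices G m \<Omega> z)"
proof -
  let ?Z = "integer_mod_group m"
  have pd: "positive_definite G f" using f by (simp add: F_sharp_def)
  have "positive_definite ?Z (\<lambda>k. f (z [^] k))"
    unfolding positive_definite_def
  proof (intro allI impI)
    fix n :: nat and x :: "nat \<Rightarrow> int" and c :: "nat \<Rightarrow> complex"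
    assume x: "\<forall>j<n. x j \<in> carrier ?Z"
    have eq: "z [^] (x j \<otimes>\<^bsub>?Z\<^esub> inv\<^bsub>?Z\<^esub> (x k)) = z [^] x j \<otimes> inv (z [^] x k)" if "k < n" for j k
      using x that z int_pow_mod_ord[OF z m(1)] int_pow_diff[OF z]
      by (simp add: mod_add_right_eq)
    have "(\<Sum>j<n. \<Sum>k<n. c j * cnj (c k) * f (z [^] (x j \<otimes>\<^bsub>?Z\<^esub> inv\<^bsub>?Z\<^esub> (x k)))) =
        (\<Sum>j<n. \<Sum>k<n. c j * cnj (c k) * f (z [^] x j \<otimes> inv (z [^] x k)))"
      by (intro sum.cong refl, subst eq) auto
    also have "\<dots> \<in> \<real>\<^sub>\<ge>\<^sub>0"
      using pd[unfolded positive_definite_def, rule_format, of n "\<lambda>j. z [^] x j" c] z by simp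
    finally show "(\<Sum>j<n. \<Sum>k<n. c j * cnj (c k) * f (z [^] (x j \<otimes>\<^bsub>?Z\<^esub> inv\<^bsub>?Z\<^esub> (x k)))) \<in> \<real>\<^sub>\<ge>\<^sub>0" .
  qed
  then show ?thesis
    using f z by (auto simp: F_cyclic_def F_sharp_def power_indices_def)
qed

end

theorem theorem34:
  fixes G :: "('a, 'b) monoid_scheme" and T :: "'a topology"
    and \<Omega> :: "'a set" and z :: 'a and m :: nat
  assumes "locally_compact_group G T"
    and "openin T \<Omega>" and "\<one>\<^bsub>G\<^esub> \<in> \<Omega>" and "\<Omega> = set_inv\<^bsub>G\<^esub> \<Omega>"
    and "z \<in> \<Omega>" and "group.ord G z = m" and "m > 0"
  shows "C_cont G T \<Omega> z = C_sharp G \<Omega> z \<and>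
         C_sharp G \<Omega> z = C_cyclic m (power_indices G m \<Omega> z) \<and>
         K_cont G T \<Omega> z = K_sharp G \<Omega> z \<and>
         K_sharp G \<Omega> z = K_cyclic m (power_indices G m \<Omega> z)"
proof -
  interpret locally_compact_group G T by fact
  define H where "H = power_indices G m \<Omega> z"
  let ?R = "real_valued G" and ?RZ = "real_valued (integer_mod_group m)"
  have z: "z \<in> carrier G" using assms(2,5) openin_subset topspace_carrier by blast
  \<comment> \<open>This includes \<open>m = 1\<close>, where the exponent is 0 and \<open>z\<close>
    is the unit.\<close>
  have z1: "z [^]\<^bsub>G\<^esub> (1 mod int m) = z"
    using int_pow_mod_ord[OF z assms(6), of 1] z by simp
  have down: "cmod ` (\<lambda>f. f z) ` (F_sharp G \<Omega> \<inter> R) \<subseteq> cmod ` (\<lambda>\<phi>. \<phi> (1 mod int m)) ` (F_cyclic m H \<inter> RZ)"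
    if "\<And>f. f \<in> R \<Longrightarrow> (\<lambda>k. f (z [^]\<^bsub>G\<^esub> k)) \<in> RZ" for R RZ
  proof clarify
    fix f assume f: "f \<in> F_sharp G \<Omega>" "f \<in> R"
    let ?\<phi> = "\<lambda>k::int. f (z [^]\<^bsub>G\<^esub> k)"
    have "?\<phi> \<in> F_cyclic m H \<inter> RZ"
      using F_sharp_restrict_cyclic[OF z assms(6,7) f(1)] that[OF f(2)] unfolding H_def by blast
    then have "cmod (?\<phi> (1 mod int m)) \<in> cmod ` (\<lambda>\<phi>. \<phi> (1 mod int m)) ` (F_cyclic m H \<inter> RZ)"
      by (intro imageI)
    then show "cmod (f z) \<in> cmod ` (\<lambda>\<phi>. \<phi> (1 mod int m)) ` (F_cyclic m H \<inter> RZ)"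
      unfolding z1 .
  qed
  \<comment> \<open>The two pairs are the unrestricted and the real-valued problem, so one argument
    serves both chains of equalities.\<close>
  have up: "cmod ` (\<lambda>\<phi>. \<phi> (1 mod int m)) ` (F_cyclic m H \<inter> RZ) \<subseteq> cmod ` (\<lambda>f. f z) ` (F_cont G T \<Omega> \<inter> R)"
    if "(R, RZ) = (UNIV, UNIV) \<or> (R, RZ) = (?R, ?RZ)" for R RZ
  proof clarify
    fix \<phi> assume \<phi>: "\<phi> \<in> F_cyclic m H" "\<phi> \<in> RZ"
    obtain f where "f \<in> F_cont G T \<Omega>" "f z = \<phi> (1 mod int m)" "\<phi> \<in> ?RZ \<Longrightarrow> f \<in> ?R"
      using cyclic_extension[OF assms(2) z assms(6,7)] \<phi>(1) unfolding H_def by metis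
    then show "cmod (\<phi> (1 mod int m)) \<in> cmod ` (\<lambda>f. f z) ` (F_cont G T \<Omega> \<inter> R)"
      using \<phi>(2) that by (force simp: image_image intro!: image_eqI[of _ _ f])
  qed
  have sub: "cmod ` (\<lambda>f. f z) ` (F_cont G T \<Omega> \<inter> R) \<subseteq> cmod ` (\<lambda>f. f z) ` (F_sharp G \<Omega> \<inter> R)" for R
    using F_cont_subset_F_sharp by blast
  have R: "(\<lambda>k. f (z [^]\<^bsub>G\<^esub> k)) \<in> ?RZ" if "f \<in> ?R" for f
    using that z by (simp add: real_valued_def)
  \<comment> \<open>The three inclusions form a cycle. Equality of the value sets gives equality of
    the suprema without any discussion of boundedness.\<close>
  have eqs: "cmod ` (\<lambda>f. f z) ` (F_cont G T \<Omega> \<inter> R) = cmod ` (\<lambda>f. f z) ` (F_sharp G \<Omega> \<inter> R)"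
    "cmod ` (\<lambda>f. f z) ` (F_sharp G \<Omega> \<inter> R) = cmod ` (\<lambda>\<phi>. \<phi> (1 mod int m)) ` (F_cyclic m H \<inter> RZ)"
    if RZ: "(R, RZ) = (UNIV, UNIV) \<or> (R, RZ) = (?R, ?RZ)" for R RZ
  proof -
    have "(\<lambda>k. f (z [^]\<^bsub>G\<^esub> k)) \<in> RZ" if "f \<in> R" for f
      using RZ R that by auto
    from sub[of R] down[OF this] up[OF RZ]
    show "cmod ` (\<lambda>f. f z) ` (F_cont G T \<Omega> \<inter> R) = cmod ` (\<lambda>f. f z) ` (F_sharp G \<Omega> \<inter> R)"
      "cmod ` (\<lambda>f. f z) ` (F_sharp G \<Omega> \<inter> R) = cmod ` (\<lambda>\<phi>. \<phi> (1 mod int m)) ` (F_cyclic m H \<inter> RZ)"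
      by (meson subset_antisym order.trans)+
  qed
  show ?thesis
    unfolding C_cont_def C_sharp_def C_cyclic_def K_cont_def K_sharp_def K_cyclic_def H_def[symmetric]
    using eqs[of UNIV UNIV] eqs[of ?R ?RZ] by (simp add: image_image)
qed

end
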